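(* Let $a,b\in\mathcal{R}$ with $\mathrm{ord}(a)=i$, $\mathrm{ord}(b)=j$ and $i\ge j\ge0$, let $d\in\mathcal{M}$ be a common divisor of $\mathrm{top}(a)$ and $\mathrm{top}(b)$ in $\mathcal{M}$, and let $a',b'\in\mathcal{M}$ satisfy $\mathrm{top}(a)=a'd$ and $\mathrm{top}(b)=b'd$. Then: (1) $\mathrm{top}(b)^{i-j}b'a=cb+c'$ for some $c\in\mathcal{R}$ with $\mathrm{ord}(c)=i-j$ and some $c'\in\mathcal{R}$ with $\mathrm{ord}(c')<j$; (2) $a\,\mathrm{top}(b)^{i-j}b'=bc+c'$ for some $c\in\mathcal{R}$ with $\mathrm{ord}(c)=i-j$ and some $c'\in\mathcal{R}$ with $\mathrm{ord}(c')<j$.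
   Context: Let $\mathrm{Hol}$ be the space of holomorphic functions on the upper half plane, $q=e^{2\pi iz}$, $f'=\frac{1}{2\pi i}\frac{df}{dz}$, and $E_2,E_4,E_6$ the Eisenstein series with constant term $1$. For $k\in\mathbb{R}$ let $D_kf=f'-\frac{k}{12}E_2f$. Let $H=\bigoplus_{n\in\mathbb{R}}H_n$ where each $H_n$ is a copy of $\mathrm{Hol}$, elements written $(f,n)$, with product $(f,n)(g,m)=(fg,n+m)$. $\mathrm{End}^i(H)$ denotes the $\mathbb{C}$-linear maps sending each $H_n$ into $H_{n+i}$ and $\mathrm{End}(H)=\bigoplus_i\mathrm{End}^i(H)$. Define $\delta(f,n)=(D_nf,n+2)$, $e_4(f,n)=(E_4f,n+4)$, $e_6(f,n)=(E_6f,n+6)$; $\mathcal{R}$ is the $\mathbb{C}$-subalgebra of $\mathrm{End}(H)$ generated by $\delta,e_4,e_6$. The ring $\mathcal{M}=\mathbb{C}[E_4,E_6]$ of level-one holomorphic modular forms is identified with the subalgebra of $\mathcal{R}$ generated by $e_4,e_6$ via $E_4\mapsto e_4$, $E_6\mapsto e_6$ (a modular form $g$ of weight $w$ acts by $(f,n)\mapsto(gf,n+w)$). Every nonzero $a\in\mathcal{R}$ has a unique expression $a=a_n\delta^n+\cdots+a_1\delta+a_0$ with $a_i\in\mathcal{M}$ and $a_n\neq0$; then $\mathrm{top}(a)=a_n$ and $\mathrm{ord}(a)=n$. For $a=0$, $\mathrm{top}(a)=0$ and $\mathrm{ord}(a)=-\infty$. *)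

theory Defs
  imports "HOL-Analysis.Analysis" "HOL-Library.Extended_Real"
begin

definition UHP :: "complex set" where "UHP = {z. Im z > 0}"

definition qpar :: "complex \<Rightarrow> complex" where
  "qpar z = exp (2 * of_real pi * \<i> * z)"

definition divsum :: "nat \<Rightarrow> nat \<Rightarrow> nat" where
  "divsum k n = (\<Sum>d | d dvd n. d ^ k)"

definition E2 :: "complex \<Rightarrow> complex" where
  "E2 z = 1 - 24 * (\<Sum>n. of_nat (divsum 1 (Suc n)) * qpar z ^ Suc n)"
definition E4 :: "complex \<Rightarrow> complex" where
  "E4 z = 1 + 240 * (\<Sum>n. of_nat (divsum 3 (Suc n)) * qpar z ^ Suc n)"
definition E6 :: "complex \<Rightarrow> complex" where
  "E6 z = 1 - 504 * (\<Sum>n. of_nat (divsum 5 (Suc n)) * qpar z ^ Suc n)"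

text \<open>f' = (1/(2 pi i)) df/dz and D_k f = f' - (k/12) E2 f, on UHP (0 outside, canonical representative).\<close>
definition Dk :: "real \<Rightarrow> (complex \<Rightarrow> complex) \<Rightarrow> (complex \<Rightarrow> complex)" where
  "Dk k f = (\<lambda>z. if Im z > 0
      then deriv f z / (2 * of_real pi * \<i>) - of_real (k / 12) * E2 z * f z else 0)"

text \<open>An element of H = (+)_{n in R} H_n is a finitely supported family of holomorphic
  functions on UHP, indexed by the weight n; functions are normalised to 0 off UHP.\<close>
type_synonym hel = "real \<Rightarrow> complex \<Rightarrow> complex"
type_synonym rop = "hel \<Rightarrow> hel"

definition Hset :: "hel set" where
  "Hset = {F. finite {n. F n \<noteq> (\<lambda>_. 0)} \<and>
       (\<forall>n. F n holomorphic_on UHP \<and> (\<forall>z. Im z \<le> 0 \<longrightarrow> F n z = 0))}"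

text \<open>Operators are only considered on H; restr makes them canonical (0 outside H).\<close>
definition restr :: "rop \<Rightarrow> rop" where
  "restr T = (\<lambda>F. if F \<in> Hset then T F else (\<lambda>_ _. 0))"

definition scal :: "complex \<Rightarrow> rop" where
  "scal c = restr (\<lambda>F m z. c * F m z)"

definition addo :: "rop \<Rightarrow> rop \<Rightarrow> rop" where
  "addo a b = (\<lambda>F m z. a F m z + b F m z)"

definition compo :: "rop \<Rightarrow> rop \<Rightarrow> rop" where
  "compo a b = restr (\<lambda>F. a (b F))"

text \<open>delta (f,n) = (D_n f, n+2)\<close>
definition delta :: rop where
  "delta = restr (\<lambda>F m. Dk (m - 2) (F (m - 2)))"

definition mulw :: "(complex \<Rightarrow> complex) \<Rightarrow> real \<Rightarrow> rop" where
  "mulw g w = restr (\<lambda>F m z. if Im z > 0 then g z * F (m - w) z else 0)"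

definition e4 :: rop where "e4 = mulw E4 4"
definition e6 :: rop where "e6 = mulw E6 6"

inductive_set Rset :: "rop set" where
  R_delta: "delta \<in> Rset"
| R_e4: "e4 \<in> Rset"
| R_e6: "e6 \<in> Rset"
| R_scal: "scal c \<in> Rset"
| R_add: "a \<in> Rset \<Longrightarrow> b \<in> Rset \<Longrightarrow> addo a b \<in> Rset"
| R_comp: "a \<in> Rset \<Longrightarrow> b \<in> Rset \<Longrightarrow> compo a b \<in> Rset"

text \<open>M = C[E4,E6], identified with the subalgebra generated by e4, e6.\<close>
inductive_set Mset :: "rop set" where
  M_e4: "e4 \<in> Mset"
| M_e6: "e6 \<in> Mset"
| M_scal: "scal c \<in> Mset"
| M_add: "a \<in> Mset \<Longrightarrow> b \<in> Mset \<Longrightarrow> addo a b \<in> Mset"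
| M_comp: "a \<in> Mset \<Longrightarrow> b \<in> Mset \<Longrightarrow> compo a b \<in> Mset"

primrec opow :: "rop \<Rightarrow> nat \<Rightarrow> rop" where
  "opow a 0 = scal 1"
| "opow a (Suc k) = compo a (opow a k)"

primrec osum :: "(nat \<Rightarrow> rop) \<Rightarrow> nat \<Rightarrow> rop" where
  "osum cs 0 = compo (cs 0) (opow delta 0)"
| "osum cs (Suc n) = addo (osum cs n) (compo (cs (Suc n)) (opow delta (Suc n)))"

definition dexpr :: "rop \<Rightarrow> nat \<Rightarrow> (nat \<Rightarrow> rop) \<Rightarrow> bool" where
  "dexpr a n cs \<longleftrightarrow> (\<forall>k\<le>n. cs k \<in> Mset) \<and> cs n \<noteq> scal 0 \<and> a = osum cs n"

definition ord :: "rop \<Rightarrow> ereal" where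
  "ord a = (if a = scal 0 then -\<infinity> else ereal (real (THE n. \<exists>cs. dexpr a n cs)))"

definition top :: "rop \<Rightarrow> rop" where
  "top a = (if a = scal 0 then scal 0 else (THE t. \<exists>n cs. dexpr a n cs \<and> t = cs n))"

end

theory Submission
  imports Defs "HOL-Complex_Analysis.Complex_Analysis"
begin

text \<open>
  Ramanujan's identities \<open>D\<^sub>4 E\<^sub>4 = - E\<^sub>6 / 3\<close> and \<open>D\<^sub>6 E\<^sub>6 = - E\<^sub>4\<^sup>2 / 2\<close> say that commutation with \<open>\<delta>\<close> is a
  derivation of \<open>M\<close>, so every element of \<open>R\<close> is a left polynomial in \<open>\<delta>\<close> over the commutative ring \<open>M\<close>, and
  leading coefficients multiply. Such an expression is unique, because \<open>\<delta>\<^sup>n\<close> is the only power up to \<open>n\<close>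
  that does not kill \<open>(z - z\<^sub>0)\<^sup>n\<close> at \<open>z\<^sub>0\<close>; and \<open>M\<close> is a domain by the identity theorem. The
  claims are then pseudo-division in an Ore extension: the common divisor \<open>d\<close> makes the first
  elimination step cost only the factor \<open>b'\<close>, and each of the remaining \<open>i - j\<close> steps costs one factor \<open>top b\<close>.

  Ramanujan's identities are equivalent to convolution identities between divisor sums, which
  follow from an elementary identity of Liouville type for sums over the solutions of \<open>a x + b y = n\<close>.
\<close>

subsection \<open>A Liouville identity\<close>

text \<open>Ramanujan's identities are usually read off from the transformation law of
  \<open>E2\<close> and from dimension formulas. Here the Eisenstein series are given as q-series,
  so the identities are proved coefficientwise, as identities of formal power series, and only then
  carried to the half plane. Their purpose is to keep the commutators of \<open>delta\<close> with
  \<open>e4\<close> and \<open>e6\<close> inside \<open>Mset\<close>. An element of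
  \<open>Mset\<close> may be inhomogeneous, so it is not multiplication by a single function. Its
  values at a point are therefore encoded by a polynomial that records the weights, and the ring
  properties of \<open>Mset\<close> are inherited from complex polynomials. \<open>ord\<close> and
  \<open>top\<close> are definite descriptions, which say nothing before uniqueness is settled. The
  division is therefore carried out with a relation, \<open>leads x n s\<close>, that also admits
  \<open>s = 0\<close>. That \<open>Mset\<close> is a domain enters at the end: the leading
  coefficient of the quotient is a product of nonzero elements, so the order of the quotient is
  exactly \<open>i - j\<close>.\<close>

definition quads :: "nat \<Rightarrow> (nat \<times> nat \<times> nat \<times> nat) set" where
  "quads n = {(a, b, x, y). 0 < a \<and> 0 < b \<and> 0 < x \<and> 0 < y \<and> a * x + b * y = n}"

lemma finite_quads: "finite (quads n)"
proof (rule finite_subset)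
  show "quads n \<subseteq> {..n} \<times> {..n} \<times> {..n} \<times> {..n}"
  proof (clarsimp simp: quads_def, intro conjI)
    fix a b x y :: nat assume *: "0 < a" "0 < b" "0 < x" "0 < y"
    have "a * 1 \<le> a * x" "1 * x \<le> a * x" "b * 1 \<le> b * y" "1 * y \<le> b * y"
      using * by (intro mult_mono; simp)+
    then show "a \<le> a * x + b * y" "b \<le> a * x + b * y" "x \<le> a * x + b * y" "y \<le> a * x + b * y"
      by linarith+
  qed
qed auto

text \<open>The summand depends on the parts \<open>a\<close>, \<open>b\<close> alone; the
  multipliers \<open>x\<close>, \<open>y\<close> enter through the region \<open>P\<close>. Keeping
  the index set fixed makes splitting into regions a termwise matter.\<close>

definition qsum ::
  "nat \<Rightarrow> (nat \<Rightarrow> nat \<Rightarrow> nat \<Rightarrow> nat \<Rightarrow> bool) \<Rightarrow> (nat \<Rightarrow> nat \<Rightarrow> 'a) \<Rightarrow> 'a::comm_ring_1" where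
  "qsum n P g = (\<Sum>(a,b,x,y)\<in>quads n. if P a b x y then g a b else 0)"

lemma qsum_filter: "qsum n P g = (\<Sum>(a,b,x,y)\<in>{(a,b,x,y)\<in>quads n. P a b x y}. g a b)"
proof -
  have "{(a,b,x,y)\<in>quads n. P a b x y} = {q\<in>quads n. case q of (a,b,x,y) \<Rightarrow> P a b x y}"
    by auto
  then show ?thesis
    by (simp add: qsum_def sum.inter_filter[OF finite_quads]) (rule sum.cong, auto)
qed

lemma qsum_cong:
  "(\<And>a b x y. (a,b,x,y) \<in> quads n \<Longrightarrow> P a b x y \<Longrightarrow> g a b = h a b) \<Longrightarrow> qsum n P g = qsum n P h"
  unfolding qsum_def by (rule sum.cong) auto

lemma qsum_add: "qsum n P (\<lambda>a b. g a b + h a b) = qsum n P g + qsum n P h"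
  unfolding qsum_def sum.distrib[symmetric] by (rule sum.cong) auto

lemma qsum_diff: "qsum n P (\<lambda>a b. g a b - h a b) = qsum n P g - qsum n P h"
  unfolding qsum_def sum_subtractf[symmetric] by (rule sum.cong) auto

lemma qsum_cmult: "qsum n P (\<lambda>a b. c * g a b) = c * qsum n P g"
  unfolding qsum_def sum_distrib_left by (rule sum.cong) auto

lemma qsum_split_parts:
  "qsum n (\<lambda>_ _ _ _. True) g =
     qsum n (\<lambda>a b x y. b < a) g + qsum n (\<lambda>a b x y. a < b) g + qsum n (\<lambda>a b x y. a = b) g"
  unfolding qsum_def sum.distrib[symmetric] by (rule sum.cong) auto

lemma qsum_split_multipliers:
  "qsum n (\<lambda>_ _ _ _. True) g =
     qsum n (\<lambda>a b x y. x < y) g + qsum n (\<lambda>a b x y. y < x) g + qsum n (\<lambda>a b x y. x = y) g"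
  unfolding qsum_def sum.distrib[symmetric] by (rule sum.cong) auto

lemma qsum_swap: "qsum n (\<lambda>a b x y. a < b) (\<lambda>a b. g b a) = qsum n (\<lambda>a b x y. b < a) g"
  unfolding qsum_filter
  by (rule sum.reindex_bij_witness[where i = "\<lambda>(a,b,x,y). (b,a,y,x)" and j = "\<lambda>(a,b,x,y). (b,a,y,x)"])
     (auto simp: quads_def)

text \<open>A Euclidean step, \<open>a x + b y = (a + b) x + b (y - x)\<close>, is a bijection that
  trades a comparison of multipliers for a comparison of parts.\<close>

lemma qsum_shift_fst:
  "qsum n (\<lambda>a b x y. x < y) (\<lambda>a b. g (a + b) b) = qsum n (\<lambda>a b x y. b < a) g"
proof -
  have *: "(a - b) * x + b * (x + y) = a * x + b * y" if "b < a" for a b x y :: nat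
    using that by (auto simp: less_iff_Suc_add algebra_simps)
  have **: "(a + b) * x + b * (y - x) = a * x + b * y" if "x < y" for a b x y :: nat
    using that by (auto simp: less_iff_Suc_add algebra_simps)
  show ?thesis unfolding qsum_filter
    by (rule sum.reindex_bij_witness[where i = "\<lambda>(a,b,x,y). (a - b, b, x, x + y)"
        and j = "\<lambda>(a,b,x,y). (a + b, b, x, y - x)"])
     (auto simp: quads_def * **)
qed

lemma qsum_shift_snd:
  "qsum n (\<lambda>a b x y. y < x) (\<lambda>a b. g a (a + b)) = qsum n (\<lambda>a b x y. a < b) g"
proof -
  have *: "a * (x + y) + (b - a) * y = a * x + b * y" if "a < b" for a b x y :: nat
    using that by (auto simp: less_iff_Suc_add algebra_simps)
  have **: "a * (x - y) + (a + b) * y = a * x + b * y" if "y < x" for a b x y :: nat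
    using that by (auto simp: less_iff_Suc_add algebra_simps)
  show ?thesis unfolding qsum_filter
    by (rule sum.reindex_bij_witness[where i = "\<lambda>(a,b,x,y). (a, b - a, x + y, y)"
        and j = "\<lambda>(a,b,x,y). (a, a + b, x - y, y)"])
     (auto simp: quads_def * **)
qed

text \<open>For \<open>a = b = d\<close> the equation reads \<open>x + y = n div d\<close>, which
  leaves \<open>n div d - 1\<close> choices of \<open>x\<close>.\<close>

lemma qsum_diagonal_parts:
  assumes "n > 0"
  shows "qsum n (\<lambda>a b x y. a = b) g = (\<Sum>d | d dvd n. of_nat (n div d - 1) * g d d)"
proof -
  have 1: "d * x + d * (k - x) = d * k" if "x < k" for d x k :: nat
    using that by (simp add: distrib_left[symmetric])
  have 2: "(d * x + d * y) div d = x + y" if "0 < d" for d x y :: nat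
    using that by (simp add: distrib_left[symmetric])
  have "qsum n (\<lambda>a b x y. a = b) g = (\<Sum>(d,x)\<in>(SIGMA d:{d. d dvd n}. {1..<n div d}). g d d)"
    unfolding qsum_filter
    by (rule sum.reindex_bij_witness[where i = "\<lambda>(d,x). (d,d,x,n div d - x)" and j = "\<lambda>(a,b,x,y). (a,x)"])
       (use assms in \<open>auto simp: quads_def 1 2 elim!: dvdE\<close>)
  also have "\<dots> = (\<Sum>d | d dvd n. \<Sum>x\<in>{1..<n div d}. g d d)"
    using assms by (intro sum.Sigma[symmetric]) auto
  finally show ?thesis by simp
qed

text \<open>For \<open>x = y\<close> the sum \<open>d = a + b\<close> is a divisor of
  \<open>n\<close> and \<open>x\<close> is the complementary one.\<close>

lemma qsum_diagonal_multipliers: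
  assumes "n > 0"
  shows "qsum n (\<lambda>a b x y. x = y) g = (\<Sum>d | d dvd n. \<Sum>a\<in>{1..<d}. g a (d - a))"
proof -
  have "qsum n (\<lambda>a b x y. x = y) g = (\<Sum>(d,a)\<in>(SIGMA d:{d. d dvd n}. {1..<d}). g a (d - a))"
    unfolding qsum_filter
    by (rule sum.reindex_bij_witness[where i = "\<lambda>(d,a). (a,d-a,n div d,n div d)" and j = "\<lambda>(a,b,x,y). (a+b,a)"])
       (use assms in \<open>auto simp: quads_def distrib_right[symmetric] elim!: dvdE\<close>)
  also have "\<dots> = (\<Sum>d | d dvd n. \<Sum>a\<in>{1..<d}. g a (d - a))"
    using assms by (intro sum.Sigma[symmetric]) auto
  finally show ?thesis .
qed

text \<open>
  The shift bijections, together with the exchange of \<open>(a, x)\<close> and \<open>(b, y)\<close>, cancel everything on the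
  left-hand side except for the diagonals \<open>a = b\<close> and \<open>x = y\<close>.
\<close>

lemma liouville_identity:
  fixes f :: "'a::comm_ring_1 \<Rightarrow> 'a \<Rightarrow> 'a"
  assumes even: "\<And>a b. f (- a) (- b) = f a b"
  defines "F \<equiv> \<lambda>a b. f (of_nat a) (of_nat b)"
  shows "qsum n (\<lambda>_ _ _ _. True) (\<lambda>a b. F a b - f (of_nat a) (- of_nat b)
             + f (of_nat a) (of_nat a - of_nat b) - F a (a + b)
             + f (of_nat b - of_nat a) (of_nat b) - F (a + b) b)
       = qsum n (\<lambda>a b x y. a = b) (\<lambda>a b. F a a + F a 0 + F 0 a)
       - qsum n (\<lambda>a b x y. x = y) (\<lambda>a b. f (of_nat a) (- of_nat b) + F (a + b) b + F a (a + b))"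
proof -
  let ?T = "\<lambda>_ _ _ _. True"
  define G1 where "G1 = (\<lambda>a b::nat. f (of_nat a) (- of_nat b))"
  define G2 where "G2 = (\<lambda>a b::nat. f (of_nat a) (of_nat a - of_nat b))"
  define G3 where "G3 = (\<lambda>a b::nat. f (of_nat b - of_nat a) (of_nat b))"
  have s1: "qsum n ?T (\<lambda>a b. F (a + b) b)
     = qsum n (\<lambda>a b x y. b < a) F + qsum n (\<lambda>a b x y. b < a) G2 + qsum n (\<lambda>a b x y. x = y) (\<lambda>a b. F (a + b) b)"
  proof -
    have "qsum n (\<lambda>a b x y. y < x) (\<lambda>a b. F (a + b) b) = qsum n (\<lambda>a b x y. y < x) (\<lambda>a b. G2 (a + b) a)"
      by (simp add: F_def G2_def)
    also have "\<dots> = qsum n (\<lambda>a b x y. a < b) (\<lambda>a b. G2 b a)"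
      by (rule qsum_shift_snd[where g = "\<lambda>a b. G2 b a"])
    also have "\<dots> = qsum n (\<lambda>a b x y. b < a) G2" by (rule qsum_swap)
    finally show ?thesis
      by (subst qsum_split_multipliers) (simp add: qsum_shift_fst)
  qed
  have s2: "qsum n ?T (\<lambda>a b. F a (a + b))
     = qsum n (\<lambda>a b x y. a < b) G3 + qsum n (\<lambda>a b x y. a < b) F + qsum n (\<lambda>a b x y. x = y) (\<lambda>a b. F a (a + b))"
  proof -
    have "qsum n (\<lambda>a b x y. x < y) (\<lambda>a b. F a (a + b)) = qsum n (\<lambda>a b x y. x < y) (\<lambda>a b. G3 b (a + b))"
      by (simp add: F_def G3_def)
    also have "\<dots> = qsum n (\<lambda>a b x y. b < a) (\<lambda>a b. G3 b a)"
      by (rule qsum_shift_fst[where g = "\<lambda>a b. G3 b a"])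
    also have "\<dots> = qsum n (\<lambda>a b x y. a < b) G3" by (rule qsum_swap[symmetric])
    finally show ?thesis
      by (subst qsum_split_multipliers) (simp add: qsum_shift_snd)
  qed
  \<comment> \<open>The only use of evenness: \<open>f(a, -b) = f(-a, b)\<close>, and the latter is
    \<open>G3 (a + b) b\<close>.\<close>
  have s3: "qsum n (\<lambda>a b x y. b < a) G3 = qsum n (\<lambda>a b x y. x < y) G1"
  proof -
    have "qsum n (\<lambda>a b x y. x < y) G1 = qsum n (\<lambda>a b x y. x < y) (\<lambda>a b. G3 (a + b) b)"
    proof (rule qsum_cong)
      fix a b
      show "G1 a b = G3 (a + b) b"
        using even[of "of_nat a" "- of_nat b"] by (simp add: G1_def G3_def)
    qed
    then show ?thesis by (simp add: qsum_shift_fst)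
  qed
  have s4: "qsum n (\<lambda>a b x y. a < b) G2 = qsum n (\<lambda>a b x y. y < x) G1"
  proof -
    have "qsum n (\<lambda>a b x y. y < x) G1 = qsum n (\<lambda>a b x y. y < x) (\<lambda>a b. G2 a (a + b))"
      by (simp add: G1_def G2_def)
    then show ?thesis by (simp add: qsum_shift_snd)
  qed
  have F: "qsum n ?T F = qsum n (\<lambda>a b x y. b < a) F + qsum n (\<lambda>a b x y. a < b) F + qsum n (\<lambda>a b x y. a = b) (\<lambda>a b. F a a)"
    by (subst qsum_split_parts) (simp, rule qsum_cong, simp)
  have G2: "qsum n ?T G2 = qsum n (\<lambda>a b x y. b < a) G2 + qsum n (\<lambda>a b x y. a < b) G2 + qsum n (\<lambda>a b x y. a = b) (\<lambda>a b. F a 0)"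
    by (subst qsum_split_parts) (simp, rule qsum_cong, simp add: G2_def F_def)
  have G3: "qsum n ?T G3 = qsum n (\<lambda>a b x y. b < a) G3 + qsum n (\<lambda>a b x y. a < b) G3 + qsum n (\<lambda>a b x y. a = b) (\<lambda>a b. F 0 a)"
    by (subst qsum_split_parts) (simp, rule qsum_cong, simp add: G3_def F_def)
  have G1: "qsum n ?T G1 = qsum n (\<lambda>a b x y. x < y) G1 + qsum n (\<lambda>a b x y. y < x) G1 + qsum n (\<lambda>a b x y. x = y) G1"
    by (rule qsum_split_multipliers)
  have "qsum n ?T (\<lambda>a b. F a b - G1 a b + G2 a b - F a (a + b) + G3 a b - F (a + b) b)
     = qsum n (\<lambda>a b x y. a = b) (\<lambda>a b. F a a + F a 0 + F 0 a)
       - qsum n (\<lambda>a b x y. x = y) (\<lambda>a b. G1 a b + F (a + b) b + F a (a + b))"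
    unfolding qsum_add qsum_diff s1 s2 F G1 G2 G3 s3 s4 by (simp add: algebra_simps)
  then show ?thesis by (simp only: G1_def G2_def G3_def)
qed

subsection \<open>Convolutions of divisor sums\<close>

text \<open>All positive integers divide \<open>0\<close>, and a sum over an infinite set is \<open>0\<close>.\<close>

lemma divsum_0 [simp]: "divsum k 0 = 0"
  by (simp add: divsum_def dvd_0_right UNIV_def[symmetric] infinite_UNIV_nat)

text \<open>Write \<open>m = a x\<close> and \<open>n - m = b y\<close>. The end terms vanish
  because \<open>divsum k 0 = 0\<close>, in agreement with the positivity required in
  \<open>quads\<close>.\<close>

lemma divsum_convolution:
  "(\<Sum>m\<le>n. divsum p m * divsum q (n - m)) = (\<Sum>(a,b,x,y)\<in>quads n. a ^ p * b ^ q)"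
proof -
  have "(\<Sum>m\<le>n. divsum p m * divsum q (n - m)) = (\<Sum>m\<in>{1..<n}. divsum p m * divsum q (n - m))"
    by (rule sum.mono_neutral_right) (auto simp: not_less_eq_eq le_less not_less)
  also have "\<dots> = (\<Sum>m\<in>{1..<n}. \<Sum>(a,b)\<in>{a. a dvd m} \<times> {b. b dvd n - m}. a ^ p * b ^ q)"
    by (simp add: divsum_def sum_product sum.cartesian_product)
  also have "\<dots> = (\<Sum>(m,a,b)\<in>(SIGMA m:{1..<n}. {a. a dvd m} \<times> {b. b dvd n - m}). a ^ p * b ^ q)"
    by (rule sum.Sigma) auto
  also have "\<dots> = (\<Sum>(a,b,x,y)\<in>quads n. a ^ p * b ^ q)"
    by (rule sum.reindex_bij_witness[where i = "\<lambda>(a,b,x,y). (a * x, a, b)" and j = "\<lambda>(m,a,b). (a,b,m div a,(n-m) div b)"])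
       (auto simp: quads_def elim!: dvdE intro!: Nat.gr0I split: if_splits)
  finally show ?thesis .
qed


text \<open>Faulhaber's formulas for the exponents that the two test functions of the Liouville
  identity produce on the diagonal \<open>x = y\<close>.\<close>

lemma sum_powers_below:
  fixes d :: nat
  shows "(\<Sum>a\<in>{1..<d}. of_nat a :: complex) = of_nat d ^ 2 / 2 - of_nat d / 2"
    and "(\<Sum>a\<in>{1..<d}. of_nat a ^ 2 :: complex) = of_nat d ^ 3 / 3 - of_nat d ^ 2 / 2 + of_nat d / 6"
    and "(\<Sum>a\<in>{1..<d}. of_nat a ^ 4 :: complex) =
           of_nat d ^ 5 / 5 - of_nat d ^ 4 / 2 + of_nat d ^ 3 / 3 - of_nat d / 30"
    and "(\<Sum>a\<in>{1..<d}. of_nat a ^ 5 :: complex) =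
           of_nat d ^ 6 / 6 - of_nat d ^ 5 / 2 + 5 * of_nat d ^ 4 / 12 - of_nat d ^ 2 / 12"
    and "(\<Sum>a\<in>{1..<d}. of_nat a ^ 6 :: complex) =
           of_nat d ^ 7 / 7 - of_nat d ^ 6 / 2 + of_nat d ^ 5 / 2 - of_nat d ^ 3 / 6 + of_nat d / 42"
proof -
  have *: "sum g {1..<Suc d} = sum g {1..<d} + g d" if "g 0 = 0" for g :: "nat \<Rightarrow> complex" and d
    using that by (cases d) auto
  show "(\<Sum>a\<in>{1..<d}. of_nat a :: complex) = of_nat d ^ 2 / 2 - of_nat d / 2"
  proof (induction d)
    case (Suc d)
    show ?case by (subst *, simp, subst Suc) (simp add: field_simps power2_eq_square)
  qed simp
  show "(\<Sum>a\<in>{1..<d}. of_nat a ^ 2 :: complex) = of_nat d ^ 3 / 3 - of_nat d ^ 2 / 2 + of_nat d / 6"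
  proof (induction d)
    case (Suc d)
    show ?case by (subst *, simp, subst Suc) (simp add: field_simps eval_nat_numeral)
  qed simp
  show "(\<Sum>a\<in>{1..<d}. of_nat a ^ 4 :: complex) =
           of_nat d ^ 5 / 5 - of_nat d ^ 4 / 2 + of_nat d ^ 3 / 3 - of_nat d / 30"
  proof (induction d)
    case (Suc d)
    show ?case by (subst *, simp, subst Suc) (simp add: field_simps eval_nat_numeral)
  qed simp
  show "(\<Sum>a\<in>{1..<d}. of_nat a ^ 5 :: complex) =
           of_nat d ^ 6 / 6 - of_nat d ^ 5 / 2 + 5 * of_nat d ^ 4 / 12 - of_nat d ^ 2 / 12"
  proof (induction d)
    case (Suc d)
    show ?case by (subst *, simp, subst Suc) (simp add: field_simps eval_nat_numeral)
  qed simp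
  show "(\<Sum>a\<in>{1..<d}. of_nat a ^ 6 :: complex) =
           of_nat d ^ 7 / 7 - of_nat d ^ 6 / 2 + of_nat d ^ 5 / 2 - of_nat d ^ 3 / 6 + of_nat d / 42"
  proof (induction d)
    case (Suc d)
    show ?case by (subst *, simp, subst Suc) (simp add: field_simps eval_nat_numeral)
  qed simp
qed

definition divsum_fps :: "nat \<Rightarrow> complex fps" where
  "divsum_fps k = Abs_fps (\<lambda>n. of_nat (divsum k n))"

lemma divsum_fps_nth [simp]: "fps_nth (divsum_fps k) n = of_nat (divsum k n)"
  by (simp add: divsum_fps_def)

lemma fps_X_deriv_divsum_nth:
  "fps_nth (fps_X * fps_deriv (divsum_fps k)) n = of_nat n * of_nat (divsum k n)"
  by (cases n) simp_all

lemma of_nat_divsum: "of_nat (divsum k n) = (\<Sum>d | d dvd n. of_nat d ^ k)"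
  by (simp add: divsum_def)

lemma divsum_fps_mult_nth:
  "fps_nth (divsum_fps p * divsum_fps q) n = qsum n (\<lambda>_ _ _ _. True) (\<lambda>a b. of_nat a ^ p * of_nat b ^ q)"
proof -
  have "fps_nth (divsum_fps p * divsum_fps q) n = of_nat (\<Sum>m\<le>n. divsum p m * divsum q (n - m))"
    by (simp add: fps_mult_nth divsum_fps_def atLeast0AtMost)
  also have "\<dots> = qsum n (\<lambda>_ _ _ _. True) (\<lambda>a b. of_nat a ^ p * of_nat b ^ q)"
    by (simp add: divsum_convolution qsum_def case_prod_unfold)
  finally show ?thesis .
qed

text \<open>For \<open>n = d m\<close> one has \<open>(m - 1) d^(k+1) = n d^k - d^(k+1)\<close>.
  This evaluates the diagonal \<open>a = b\<close> for a test function of degree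
  \<open>k + 1\<close>.\<close>

lemma sum_divisors_diagonal:
  assumes "n > 0"
  shows "(\<Sum>d | d dvd n. of_nat (n div d - 1) * (c * of_nat d ^ Suc k) :: complex)
       = c * (of_nat n * of_nat (divsum k n) - of_nat (divsum (Suc k) n))"
  unfolding of_nat_divsum sum_distrib_left sum_subtractf[symmetric]
proof (rule sum.cong)
  fix d assume "d \<in> {d. d dvd n}"
  then obtain m where m: "n = d * m" by (auto elim: dvdE)
  with assms have "d > 0" "m > 0" by auto
  then show "of_nat (n div d - 1) * (c * of_nat d ^ Suc k)
      = c * (of_nat n * of_nat d ^ k - of_nat d ^ Suc k :: complex)"
    by (simp add: m of_nat_diff algebra_simps)
qed simp

text \<open>The Liouville identity for the test function \<open>a^4\<close>:
  \<open>(b - a)^4 - (a + b)^4 = -8 (a^3 b + a b^3)\<close>, and both monomials sum to the same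
  convolution. The divisor sums of fourth powers from the two diagonals cancel.\<close>

lemma divsum_convolution_1_3:
  "240 * fps_nth (divsum_fps 1 * divsum_fps 3) n =
     21 * of_nat (divsum 5 n) + 10 * of_nat (divsum 3 n)
       - 30 * of_nat n * of_nat (divsum 3 n) - of_nat (divsum 1 n)"
proof (cases "n = 0")
  case False
  then have n: "n > 0" by simp
  let ?f = "\<lambda>a b :: complex. a ^ 4"
  let ?T = "\<lambda>_ _ _ _. True"
  have "qsum n ?T (\<lambda>a b. of_nat a ^ 4 - of_nat a ^ 4 + of_nat a ^ 4 - of_nat a ^ 4
          + (of_nat b - of_nat a) ^ 4 - of_nat (a + b) ^ 4)
      = qsum n ?T (\<lambda>a b. (-8 :: complex) * (of_nat a ^ 3 * of_nat b ^ 1) + (-8) * (of_nat a ^ 1 * of_nat b ^ 3))"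
    by (rule qsum_cong) (simp add: eval_nat_numeral algebra_simps)
  also have "\<dots> = -16 * fps_nth (divsum_fps 1 * divsum_fps 3) n"
    unfolding qsum_add qsum_cmult divsum_fps_mult_nth[symmetric]
    by (simp add: mult.commute[of "divsum_fps 3"])
  finally have L: "-16 * fps_nth (divsum_fps 1 * divsum_fps 3) n =
      qsum n (\<lambda>a b x y. a = b) (\<lambda>a b. of_nat a ^ 4 + of_nat a ^ 4 + of_nat 0 ^ 4)
       - qsum n (\<lambda>a b x y. x = y) (\<lambda>a b. of_nat a ^ 4 + of_nat (a + b) ^ 4 + of_nat a ^ 4)"
    using liouville_identity[of ?f n] by simp
  have "qsum n (\<lambda>a b x y. a = b) (\<lambda>a b. of_nat a ^ 4 + of_nat a ^ 4 + of_nat 0 ^ 4 :: complex)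
      = (\<Sum>d | d dvd n. of_nat (n div d - 1) * (2 * of_nat d ^ Suc 3))"
    unfolding qsum_diagonal_parts[OF n] by (simp add: eval_nat_numeral)
  then have D1: "qsum n (\<lambda>a b x y. a = b) (\<lambda>a b. of_nat a ^ 4 + of_nat a ^ 4 + of_nat 0 ^ 4 :: complex)
      = 2 * (of_nat n * of_nat (divsum 3 n) - of_nat (divsum 4 n))"
    unfolding sum_divisors_diagonal[OF n] by simp
  have "(\<Sum>a\<in>{1..<d}. of_nat a ^ 4 + of_nat (a + (d - a)) ^ 4 + of_nat a ^ 4 :: complex)
     = (7/5) * of_nat d ^ 5 - 2 * of_nat d ^ 4 + (2/3) * of_nat d ^ 3 - (1/15) * of_nat d ^ 1" for d
  proof (cases "d = 0")
    case False
    have "(\<Sum>a\<in>{1..<d}. of_nat a ^ 4 + of_nat (a + (d - a)) ^ 4 + of_nat a ^ 4 :: complex)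
        = (\<Sum>a\<in>{1..<d}. 2 * of_nat a ^ 4 + of_nat d ^ 4)"
      by (rule sum.cong) auto
    also have "\<dots> = 2 * (of_nat d ^ 5 / 5 - of_nat d ^ 4 / 2 + of_nat d ^ 3 / 3 - of_nat d / 30)
        + (of_nat d - 1) * of_nat d ^ 4"
      using False by (simp add: sum.distrib sum_distrib_left[symmetric] sum_powers_below[unfolded One_nat_def] of_nat_diff)
    also have "\<dots> = (7/5) * of_nat d ^ 5 - 2 * of_nat d ^ 4 + (2/3) * of_nat d ^ 3 - (1/15) * of_nat d ^ 1"
      by (simp add: field_simps eval_nat_numeral)
    finally show ?thesis .
  qed simp
  then have D2: "qsum n (\<lambda>a b x y. x = y) (\<lambda>a b. of_nat a ^ 4 + of_nat (a + b) ^ 4 + of_nat a ^ 4 :: complex)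
      = (7/5) * of_nat (divsum 5 n) - 2 * of_nat (divsum 4 n) + (2/3) * of_nat (divsum 3 n) - (1/15) * of_nat (divsum 1 n)"
    unfolding qsum_diagonal_multipliers[OF n] of_nat_divsum
    by (simp add: sum.distrib sum_subtractf sum_distrib_left)
  show ?thesis using arg_cong[OF L[unfolded D1 D2], of "\<lambda>t. -15 * t"] by (simp add: algebra_simps)
qed (simp add: divsum_fps_def)

text \<open>
  The test function \<open>19 a\<^sup>6 - 45 a\<^sup>4 b\<^sup>2\<close> produces the two convolutions in the ratio in which they occur in
  \<open>E\<^sub>2 E\<^sub>6 - E\<^sub>4\<^sup>2\<close>, and for it the divisor sums of seventh powers cancel.
\<close>

lemma divsum_convolution_1_5_3_3:
  "84 * fps_nth (divsum_fps 1 * divsum_fps 5) n - 400 * fps_nth (divsum_fps 3 * divsum_fps 3) n =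
     (7/2) * of_nat (divsum 5 n) + (10/3) * of_nat (divsum 3 n) + (1/6) * of_nat (divsum 1 n)
       - 7 * of_nat n * of_nat (divsum 5 n)"
proof (cases "n = 0")
  case False
  then have n: "n > 0" by simp
  define f where "f = (\<lambda>a b :: complex. 19 * a ^ 6 - 45 * a ^ 4 * b ^ 2)"
  let ?T = "\<lambda>_ _ _ _. True"
  have "qsum n ?T (\<lambda>a b. f (of_nat a) (of_nat b) - f (of_nat a) (- of_nat b)
             + f (of_nat a) (of_nat a - of_nat b) - f (of_nat a) (of_nat (a + b))
             + f (of_nat b - of_nat a) (of_nat b) - f (of_nat (a + b)) (of_nat b))
      = qsum n ?T (\<lambda>a b. (-48 :: complex) * (of_nat a ^ 5 * of_nat b ^ 1) + 132 * (of_nat a ^ 1 * of_nat b ^ 5)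
           + (-400) * (of_nat a ^ 3 * of_nat b ^ 3))"
    by (rule qsum_cong) (simp add: f_def eval_nat_numeral algebra_simps)
  \<comment> \<open>The monomials \<open>a^5 b\<close> and \<open>a b^5\<close> give the same
    convolution, and \<open>84 = 132 - 48\<close>.\<close>
  also have "\<dots> = 84 * fps_nth (divsum_fps 1 * divsum_fps 5) n - 400 * fps_nth (divsum_fps 3 * divsum_fps 3) n"
    unfolding qsum_add qsum_cmult divsum_fps_mult_nth[symmetric]
    by (simp add: mult.commute[of "divsum_fps 5"])
  finally have L: "84 * fps_nth (divsum_fps 1 * divsum_fps 5) n - 400 * fps_nth (divsum_fps 3 * divsum_fps 3) n =
      qsum n (\<lambda>a b x y. a = b) (\<lambda>a b. f (of_nat a) (of_nat a) + f (of_nat a) (of_nat 0) + f (of_nat 0) (of_nat a))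
       - qsum n (\<lambda>a b x y. x = y) (\<lambda>a b. f (of_nat a) (- of_nat b) + f (of_nat (a + b)) (of_nat b)
             + f (of_nat a) (of_nat (a + b)))"
    using liouville_identity[of f n] by (simp add: f_def)
  have "qsum n (\<lambda>a b x y. a = b) (\<lambda>a b. f (of_nat a) (of_nat a) + f (of_nat a) (of_nat 0) + f (of_nat 0) (of_nat a))
      = (\<Sum>d | d dvd n. of_nat (n div d - 1) * ((-7) * of_nat d ^ Suc 5))"
    unfolding qsum_diagonal_parts[OF n] f_def by (simp add: eval_nat_numeral algebra_simps)
  then have D1: "qsum n (\<lambda>a b x y. a = b) (\<lambda>a b. f (of_nat a) (of_nat a) + f (of_nat a) (of_nat 0) + f (of_nat 0) (of_nat a))
      = -7 * (of_nat n * of_nat (divsum 5 n) - of_nat (divsum 6 n))"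
    unfolding sum_divisors_diagonal[OF n] by simp
  have "(\<Sum>a\<in>{1..<d}. f (of_nat a) (- of_nat (d - a)) + f (of_nat (a + (d - a))) (of_nat (d - a))
             + f (of_nat a) (of_nat (a + (d - a))))
     = 7 * of_nat d ^ 6 - (7/2) * of_nat d ^ 5 - (10/3) * of_nat d ^ 3 - (1/6) * of_nat d ^ 1" for d
  proof (cases "d = 0")
    case False
    have "(\<Sum>a\<in>{1..<d}. f (of_nat a) (- of_nat (d - a)) + f (of_nat (a + (d - a))) (of_nat (d - a))
             + f (of_nat a) (of_nat (a + (d - a))))
        = (\<Sum>a\<in>{1..<d}. (-7) * of_nat a ^ 6 + 90 * of_nat d * of_nat a ^ 5 - 90 * of_nat d ^ 2 * of_nat a ^ 4
             - 45 * of_nat d ^ 4 * of_nat a ^ 2 + 90 * of_nat d ^ 5 * of_nat a - 26 * of_nat d ^ 6)"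
      by (rule sum.cong) (auto simp: f_def of_nat_diff eval_nat_numeral algebra_simps)
    also have "\<dots> = (-7) * (of_nat d ^ 7 / 7 - of_nat d ^ 6 / 2 + of_nat d ^ 5 / 2 - of_nat d ^ 3 / 6 + of_nat d / 42)
        + 90 * of_nat d * (of_nat d ^ 6 / 6 - of_nat d ^ 5 / 2 + 5 * of_nat d ^ 4 / 12 - of_nat d ^ 2 / 12)
        - 90 * of_nat d ^ 2 * (of_nat d ^ 5 / 5 - of_nat d ^ 4 / 2 + of_nat d ^ 3 / 3 - of_nat d / 30)
        - 45 * of_nat d ^ 4 * (of_nat d ^ 3 / 3 - of_nat d ^ 2 / 2 + of_nat d / 6)
        + 90 * of_nat d ^ 5 * (of_nat d ^ 2 / 2 - of_nat d / 2)
        - (of_nat d - 1) * (26 * of_nat d ^ 6)"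
      using False
      by (simp add: sum.distrib sum_subtractf sum_distrib_left[symmetric] sum_powers_below[unfolded One_nat_def] of_nat_diff
          del: sum_negf)
    also have "\<dots> = 7 * of_nat d ^ 6 - (7/2) * of_nat d ^ 5 - (10/3) * of_nat d ^ 3 - (1/6) * of_nat d ^ 1"
      by (simp add: field_simps eval_nat_numeral)
    finally show ?thesis .
  qed (simp add: f_def)
  then have D2: "qsum n (\<lambda>a b x y. x = y) (\<lambda>a b. f (of_nat a) (- of_nat b) + f (of_nat (a + b)) (of_nat b)
             + f (of_nat a) (of_nat (a + b)))
      = 7 * of_nat (divsum 6 n) - (7/2) * of_nat (divsum 5 n) - (10/3) * of_nat (divsum 3 n) - (1/6) * of_nat (divsum 1 n)"
    unfolding qsum_diagonal_multipliers[OF n] of_nat_divsum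
    by (simp add: sum.distrib sum_subtractf sum_distrib_left)
  show ?thesis unfolding L D1 D2 by (simp add: algebra_simps)
qed (simp add: divsum_fps_def)

subsection \<open>Ramanujan's identities\<close>

definition E2_fps :: "complex fps" where "E2_fps = 1 - fps_const 24 * divsum_fps 1"
definition E4_fps :: "complex fps" where "E4_fps = 1 + fps_const 240 * divsum_fps 3"
definition E6_fps :: "complex fps" where "E6_fps = 1 - fps_const 504 * divsum_fps 5"

text \<open>\<open>fps_X * fps_deriv\<close> is q d/dq, which is (1/(2 pi i)) d/dz on q-series.
  Comparing coefficients leaves 24 times \<open>divsum_convolution_1_3\<close>.\<close>

lemma ramanujan_E4_fps: "fps_const 3 * (fps_X * fps_deriv E4_fps) = E2_fps * E4_fps - E6_fps"
proof (rule fps_ext)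
  fix n
  let ?c = "fps_nth (divsum_fps 1 * divsum_fps 3) n"
  have "E2_fps * E4_fps - E6_fps = fps_const 240 * divsum_fps 3 - fps_const 24 * divsum_fps 1
       - (fps_const 24 * fps_const 240) * (divsum_fps 1 * divsum_fps 3) + fps_const 504 * divsum_fps 5"
    by (simp only: E2_fps_def E4_fps_def E6_fps_def) (simp add: algebra_simps)
  then have R: "fps_nth (E2_fps * E4_fps - E6_fps) n = 240 * of_nat (divsum 3 n) - 24 * of_nat (divsum 1 n)
       - 5760 * ?c + 504 * of_nat (divsum 5 n)"
    by simp
  have "fps_const 3 * (fps_X * fps_deriv E4_fps) = fps_const 720 * (fps_X * fps_deriv (divsum_fps 3))"
    by (simp add: E4_fps_def algebra_simps)
  then have L: "fps_nth (fps_const 3 * (fps_X * fps_deriv E4_fps)) n = 720 * (of_nat n * of_nat (divsum 3 n))"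
    by (simp only: fps_mult_left_const_nth fps_X_deriv_divsum_nth)
  have "24 * (240 * ?c) = 24 * (21 * of_nat (divsum 5 n) + 10 * of_nat (divsum 3 n)
       - 30 * of_nat n * of_nat (divsum 3 n) - of_nat (divsum 1 n))"
    by (simp only: divsum_convolution_1_3)
  then show "fps_nth (fps_const 3 * (fps_X * fps_deriv E4_fps)) n = fps_nth (E2_fps * E4_fps - E6_fps) n"
    unfolding L R by (simp add: algebra_simps)
qed

lemma ramanujan_E6_fps: "fps_const 2 * (fps_X * fps_deriv E6_fps) = E2_fps * E6_fps - E4_fps * E4_fps"
proof (rule fps_ext)
  fix n
  let ?c = "fps_nth (divsum_fps 1 * divsum_fps 5) n"
  let ?d = "fps_nth (divsum_fps 3 * divsum_fps 3) n"
  have "E2_fps * E6_fps - E4_fps * E4_fps = (fps_const 24 * fps_const 504) * (divsum_fps 1 * divsum_fps 5)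
       - (fps_const 240 * fps_const 240) * (divsum_fps 3 * divsum_fps 3) - fps_const 24 * divsum_fps 1
       - fps_const 504 * divsum_fps 5 - (fps_const 240 + fps_const 240) * divsum_fps 3"
    by (simp only: E2_fps_def E4_fps_def E6_fps_def) (simp add: algebra_simps del: fps_const_add)
  then have R: "fps_nth (E2_fps * E6_fps - E4_fps * E4_fps) n = 12096 * ?c - 57600 * ?d - 24 * of_nat (divsum 1 n)
       - 504 * of_nat (divsum 5 n) - 480 * of_nat (divsum 3 n)"
    by simp
  have "fps_const 2 * (fps_X * fps_deriv E6_fps) = fps_const (-1008) * (fps_X * fps_deriv (divsum_fps 5))"
  proof -
    have "fps_deriv E6_fps = fps_const (-504) * fps_deriv (divsum_fps 5)"
      by (simp add: E6_fps_def fps_const_neg[symmetric] del: fps_const_neg)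
    then have "fps_const 2 * (fps_X * fps_deriv E6_fps)
        = (fps_const 2 * fps_const (-504)) * (fps_X * fps_deriv (divsum_fps 5))"
      by (simp only: mult_ac)
    then show ?thesis by simp
  qed
  then have L: "fps_nth (fps_const 2 * (fps_X * fps_deriv E6_fps)) n = -1008 * (of_nat n * of_nat (divsum 5 n))"
    by (simp only: fps_mult_left_const_nth fps_X_deriv_divsum_nth)
  \<comment> \<open>The factor fits both products: \<open>24 * 504 = 144 * 84\<close> and
    \<open>240 * 240 = 144 * 400\<close>.\<close>
  have "144 * (84 * ?c - 400 * ?d) = 144 * ((7/2) * of_nat (divsum 5 n) + (10/3) * of_nat (divsum 3 n)
       + (1/6) * of_nat (divsum 1 n) - 7 * of_nat n * of_nat (divsum 5 n))"
    by (simp only: divsum_convolution_1_5_3_3)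
  then show "fps_nth (fps_const 2 * (fps_X * fps_deriv E6_fps)) n = fps_nth (E2_fps * E6_fps - E4_fps * E4_fps) n"
    unfolding L R by (simp add: algebra_simps)
qed

section \<open>Convergence of the q-expansions and passage to the upper half plane\<close>

lemma divsum_le: "divsum k n \<le> n * n ^ k"
proof (cases "n = 0")
  case False
  have "divsum k n \<le> (\<Sum>d\<in>{1..n}. d ^ k)"
    unfolding divsum_def using False by (intro sum_mono2) (auto dest: dvd_imp_le intro: Nat.gr0I)
  also have "\<dots> \<le> (\<Sum>d\<in>{1..n}. n ^ k)"
    by (intro sum_mono power_mono) auto
  finally show ?thesis by simp
qed simp

text \<open>The coefficients are dominated by \<open>n^(k+1)\<close>, whose power series has radius
  1 by the ratio test.\<close>

lemma fps_conv_radius_divsum: "fps_conv_radius (divsum_fps k) \<ge> 1"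
  unfolding fps_conv_radius_def
proof (rule conv_radius_geI_ex')
  fix r :: real assume r: "0 < r" "ereal r < 1"
  have "(\<lambda>n. (real n / real (Suc n)) ^ Suc k) \<longlonglongrightarrow> 1 ^ Suc k"
    by (intro tendsto_power LIMSEQ_n_over_Suc_n)
  then have "(\<lambda>n. norm (of_nat n ^ Suc k :: complex) / norm (of_nat (Suc n) ^ Suc k :: complex)) \<longlonglongrightarrow> 1"
    by (simp only: norm_power norm_of_nat power_divide power_one)
  then have "conv_radius (\<lambda>n. of_nat n ^ Suc k :: complex) = 1"
    by (intro conv_radius_ratio_limit[where c = 1])
       (auto simp: one_ereal_def intro!: eventually_mono[OF eventually_gt_at_top[of 0]])
  then have "summable (\<lambda>n. norm (of_nat n ^ Suc k * complex_of_real r ^ n))"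
    using r by (intro abs_summable_in_conv_radius) auto
  then have "summable (\<lambda>n. norm (of_nat (divsum k n) * complex_of_real r ^ n))"
  proof (rule summable_comparison_test_ev[rotated])
    have "real (divsum k n) \<le> real n ^ Suc k" for n
      using divsum_le[of k n] by (metis of_nat_le_iff of_nat_power power_Suc)
    then show "\<forall>\<^sub>F n in sequentially. norm (norm (of_nat (divsum k n) * complex_of_real r ^ n))
        \<le> norm (of_nat n ^ Suc k * complex_of_real r ^ n)"
      by (intro always_eventually allI)
         (simp add: norm_mult norm_power mult_right_mono del: power_Suc)
  qed
  then show "summable (\<lambda>n. fps_nth (divsum_fps k) n * of_real r ^ n)"
    by (simp add: summable_norm_cancel)
qed

lemma eval_divsum_fps:
  assumes "norm q < 1"
  shows "eval_fps (divsum_fps k) q = (\<Sum>n. of_nat (divsum k (Suc n)) * q ^ Suc n)"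
proof -
  have "ereal (norm q) < fps_conv_radius (divsum_fps k)"
    using assms fps_conv_radius_divsum[of k] by (rule_tac less_le_trans[of _ 1]) simp_all
  then have "summable (\<lambda>n. fps_nth (divsum_fps k) n * q ^ n)"
    by (intro summable_fps)
  from suminf_split_head[OF this] show ?thesis
    by (simp add: eval_fps_def)
qed

lemma fps_conv_radius_affine:
  fixes f :: "complex fps"
  assumes "fps_conv_radius f \<ge> 1"
  shows "fps_conv_radius (1 + fps_const c * f) \<ge> 1" "fps_conv_radius (1 - fps_const c * f) \<ge> 1"
proof -
  have *: "fps_conv_radius (fps_const c * f) \<ge> 1"
    using fps_conv_radius_mult[of "fps_const c" f] assms by simp
  show "fps_conv_radius (1 + fps_const c * f) \<ge> 1" "fps_conv_radius (1 - fps_const c * f) \<ge> 1"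
    using fps_conv_radius_add[of 1 "fps_const c * f"] fps_conv_radius_diff[of 1 "fps_const c * f"] * by simp_all
qed

lemma E_fps_conv_radius: "fps_conv_radius E2_fps \<ge> 1" "fps_conv_radius E4_fps \<ge> 1" "fps_conv_radius E6_fps \<ge> 1"
  unfolding E2_fps_def E4_fps_def E6_fps_def by (intro fps_conv_radius_affine fps_conv_radius_divsum)+

lemma norm_less_conv_radius:
  "norm (q :: complex) < 1 \<Longrightarrow> fps_conv_radius f \<ge> 1 \<Longrightarrow> ereal (norm q) < fps_conv_radius f"
  by (rule less_le_trans[of _ 1]) simp_all

lemma norm_qpar_less_1: "Im z > 0 \<Longrightarrow> norm (qpar z) < 1"
  by (simp add: qpar_def)

lemma E_eq_eval_fps:
  assumes "Im z > 0"
  shows "E2 z = eval_fps E2_fps (qpar z)" "E4 z = eval_fps E4_fps (qpar z)" "E6 z = eval_fps E6_fps (qpar z)"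
proof -
  note q = norm_qpar_less_1[OF assms]
  have *: "ereal (norm (qpar z)) < fps_conv_radius (fps_const c * divsum_fps k)" for c k
    using fps_conv_radius_mult[of "fps_const c" "divsum_fps k"] fps_conv_radius_divsum[of k]
    by (intro norm_less_conv_radius q) simp
  show "E2 z = eval_fps E2_fps (qpar z)" "E4 z = eval_fps E4_fps (qpar z)" "E6 z = eval_fps E6_fps (qpar z)"
    using q by (simp_all add: E2_def E4_def E6_def E2_fps_def E4_fps_def E6_fps_def eval_fps_add eval_fps_diff * eval_fps_mult
      eval_divsum_fps norm_less_conv_radius fps_conv_radius_divsum)
qed

lemma qpar_DERIV: "(qpar has_field_derivative (2 * of_real pi * \<i>) * qpar z) (at z)"
  unfolding qpar_def by (auto intro!: derivative_eq_intros)

lemma open_UHP [simp]: "open UHP" and connected_UHP [simp]: "connected UHP"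
  unfolding UHP_def by (auto simp: open_halfspace_Im_gt convex_halfspace_Im_gt intro: convex_connected)

text \<open>Since dq/dz = 2 pi i q, the chain rule turns d/dz into 2 pi i times q d/dq.\<close>

lemma eval_fps_qpar_DERIV:
  assumes "fps_conv_radius f \<ge> 1" "Im z > 0"
  shows "((\<lambda>z. eval_fps f (qpar z)) has_field_derivative
           (2 * of_real pi * \<i>) * eval_fps (fps_X * fps_deriv f) (qpar z)) (at z)"
proof -
  note q = norm_less_conv_radius[OF norm_qpar_less_1[OF assms(2)]]
  have "ereal (norm (qpar z)) < fps_conv_radius (fps_deriv f)"
    using assms(1) fps_conv_radius_deriv[of f] by (intro q) (auto intro: order_trans)
  then have "eval_fps (fps_X * fps_deriv f) (qpar z) = qpar z * eval_fps (fps_deriv f) (qpar z)"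
    by (simp add: eval_fps_mult)
  moreover have "((\<lambda>z. eval_fps f (qpar z)) has_field_derivative
           eval_fps (fps_deriv f) (qpar z) * (2 * of_real pi * \<i> * qpar z)) (at z)"
    by (rule DERIV_chain2[OF has_field_derivative_eval_fps qpar_DERIV]) (rule q[OF assms(1)])
  ultimately show ?thesis by (simp add: mult_ac)
qed

lemma holomorphic_eval_fps_qpar:
  assumes "fps_conv_radius f \<ge> 1"
  shows "(\<lambda>z. eval_fps f (qpar z)) holomorphic_on UHP"
  unfolding holomorphic_on_open[OF open_UHP]
  using eval_fps_qpar_DERIV[OF assms] by (auto simp: UHP_def)

lemma E_holomorphic: "E2 holomorphic_on UHP" "E4 holomorphic_on UHP" "E6 holomorphic_on UHP"
  by (rule holomorphic_transform[OF holomorphic_eval_fps_qpar[OF E_fps_conv_radius(1)]]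
        holomorphic_transform[OF holomorphic_eval_fps_qpar[OF E_fps_conv_radius(2)]]
        holomorphic_transform[OF holomorphic_eval_fps_qpar[OF E_fps_conv_radius(3)]],
      simp add: UHP_def E_eq_eval_fps)+

lemma E_eval_products:
  assumes "Im z > 0"
  shows "eval_fps (fps_X * fps_deriv E4_fps) (qpar z) = (E2 z * E4 z - E6 z) / 3"
    and "eval_fps (fps_X * fps_deriv E6_fps) (qpar z) = (E2 z * E6 z - E4 z * E4 z) / 2"
proof -
  note q = norm_less_conv_radius[OF norm_qpar_less_1[OF assms]]
  have mult: "ereal (norm (qpar z)) < fps_conv_radius (f * g)"
    if "fps_conv_radius f \<ge> 1" "fps_conv_radius g \<ge> 1" for f g :: "complex fps"
    using that by (intro q order_trans[OF _ fps_conv_radius_mult[of f g]]) simp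
  have deriv: "fps_conv_radius (fps_deriv f) \<ge> 1" if "fps_conv_radius f \<ge> 1" for f :: "complex fps"
    using that fps_conv_radius_deriv[of f] by (auto intro: order_trans)
  have "eval_fps (fps_const c * (fps_X * fps_deriv f)) (qpar z) = c * eval_fps (fps_X * fps_deriv f) (qpar z)"
    if "fps_conv_radius f \<ge> 1" for c f
    by (simp add: eval_fps_mult mult deriv that)
  from this[OF E_fps_conv_radius(2), of 3] this[OF E_fps_conv_radius(3), of 2]
  have "3 * eval_fps (fps_X * fps_deriv E4_fps) (qpar z) = E2 z * E4 z - E6 z"
    "2 * eval_fps (fps_X * fps_deriv E6_fps) (qpar z) = E2 z * E6 z - E4 z * E4 z"
    unfolding ramanujan_E4_fps ramanujan_E6_fps
    by (simp_all add: E_eq_eval_fps[OF assms] eval_fps_diff eval_fps_mult mult q E_fps_conv_radius)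
  then show "eval_fps (fps_X * fps_deriv E4_fps) (qpar z) = (E2 z * E4 z - E6 z) / 3"
    "eval_fps (fps_X * fps_deriv E6_fps) (qpar z) = (E2 z * E6 z - E4 z * E4 z) / 2"
    by (simp_all add: field_simps)
qed

lemma ramanujan_E4_E6:
  assumes "Im z > 0"
  shows "deriv E4 z / (2 * of_real pi * \<i>) = (E2 z * E4 z - E6 z) / 3"
    and "deriv E6 z / (2 * of_real pi * \<i>) = (E2 z * E6 z - E4 z * E4 z) / 2"
proof -
  have ev: "\<forall>\<^sub>F w in nhds z. Im w > 0"
    using eventually_nhds_in_open[OF open_UHP, of z] assms by (simp add: UHP_def)
  have "deriv E4 z = deriv (\<lambda>z. eval_fps E4_fps (qpar z)) z" "deriv E6 z = deriv (\<lambda>z. eval_fps E6_fps (qpar z)) z"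
    by (rule deriv_cong_ev; use ev in \<open>auto elim!: eventually_mono simp: E_eq_eval_fps\<close>)+
  then show "deriv E4 z / (2 * of_real pi * \<i>) = (E2 z * E4 z - E6 z) / 3"
    "deriv E6 z / (2 * of_real pi * \<i>) = (E2 z * E6 z - E4 z * E4 z) / 2"
    by (simp_all add: DERIV_imp_deriv[OF eval_fps_qpar_DERIV[OF _ assms]] E_fps_conv_radius E_eval_products[OF assms])
qed

subsection \<open>Pseudo-division in Ore extensions\<close>

text \<open>Commutation with \<open>\<delta>\<close> is a derivation of the commutative ring
  \<open>M\<close>. The division is done at this level, where an element may still have several
  expressions in \<open>\<delta>\<close>; uniqueness is added in \<open>ore_domain\<close>.\<close>

locale ore_extension =
  fixes M :: "'a::ring_1 set" and \<delta> :: 'a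
  assumes one_mem: "1 \<in> M"
    and add_mem: "x \<in> M \<Longrightarrow> y \<in> M \<Longrightarrow> x + y \<in> M"
    and uminus_mem: "x \<in> M \<Longrightarrow> - x \<in> M"
    and mult_mem: "x \<in> M \<Longrightarrow> y \<in> M \<Longrightarrow> x * y \<in> M"
    and mem_commute: "x \<in> M \<Longrightarrow> y \<in> M \<Longrightarrow> x * y = y * x"
    and commutator_mem: "x \<in> M \<Longrightarrow> \<delta> * x - x * \<delta> \<in> M"
begin

lemma zero_mem: "0 \<in> M"
  using add_mem[OF one_mem uminus_mem[OF one_mem]] by simp

lemma power_mem: "x \<in> M \<Longrightarrow> x ^ n \<in> M"
  by (induction n) (auto intro: one_mem mult_mem)

text \<open>The elements of order below \<open>n\<close>. With the strict bound
  \<open>filt 0\<close> is zero, so a remainder of order below \<open>0\<close> is no special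
  case.\<close>

definition filt :: "nat \<Rightarrow> 'a set" where
  "filt n = {x. \<exists>c. (\<forall>k. c k \<in> M) \<and> x = (\<Sum>k<n. c k * \<delta> ^ k)}"

text \<open>The coefficient \<open>s\<close> may be \<open>0\<close>, and \<open>leads x n 0\<close>
  just says that \<open>x\<close> has order below \<open>n\<close>. Thus a division step need not
  ask whether the leading term has already vanished.\<close>

definition leads :: "'a \<Rightarrow> nat \<Rightarrow> 'a \<Rightarrow> bool" where
  "leads x n s \<longleftrightarrow> s \<in> M \<and> x - s * \<delta> ^ n \<in> filt n"

lemma filt_0 [simp]: "filt 0 = {0}"
  using one_mem by (auto simp: filt_def)

lemma zero_filt: "0 \<in> filt n"
  unfolding filt_def by (auto intro!: exI[of _ "\<lambda>_. 0"] zero_mem)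

lemma filt_add:
  assumes "x \<in> filt n" "y \<in> filt n"
  shows "x + y \<in> filt n"
proof -
  obtain c d where "\<forall>k. c k \<in> M" "\<forall>k. d k \<in> M"
    "x = (\<Sum>k<n. c k * \<delta> ^ k)" "y = (\<Sum>k<n. d k * \<delta> ^ k)"
    using assms unfolding filt_def by blast
  then show ?thesis unfolding filt_def
    by (intro CollectI exI[of _ "\<lambda>k. c k + d k"]) (auto simp: sum.distrib ring_distribs intro: add_mem)
qed

lemma filt_mult_left:
  assumes "m \<in> M" "x \<in> filt n"
  shows "m * x \<in> filt n"
proof -
  obtain c where "\<forall>k. c k \<in> M" "x = (\<Sum>k<n. c k * \<delta> ^ k)"
    using assms unfolding filt_def by blast
  with assms(1) show ?thesis unfolding filt_def
    by (intro CollectI exI[of _ "\<lambda>k. m * c k"]) (auto simp: sum_distrib_left mult.assoc intro: mult_mem)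
qed

lemma filt_uminus: "x \<in> filt n \<Longrightarrow> - x \<in> filt n"
  using filt_mult_left[OF uminus_mem[OF one_mem], of x n] by simp

lemma filt_diff: "x \<in> filt n \<Longrightarrow> y \<in> filt n \<Longrightarrow> x - y \<in> filt n"
  using filt_add[OF _ filt_uminus, of x n y] by simp

lemma filt_monomial: "m \<in> M \<Longrightarrow> k < n \<Longrightarrow> m * \<delta> ^ k \<in> filt n"
  unfolding filt_def
  by (intro CollectI exI[of _ "\<lambda>l. if l = k then m else 0"])
     (auto simp: zero_mem if_distrib if_distribR sum.delta cong: if_cong)

lemma filt_Suc_leads:
  assumes "x \<in> filt (Suc n)"
  shows "\<exists>s. leads x n s"
proof -
  obtain c where c: "\<forall>k. c k \<in> M" "x = (\<Sum>k<Suc n. c k * \<delta> ^ k)"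
    using assms unfolding filt_def by blast
  then have "x - c n * \<delta> ^ n = (\<Sum>k<n. c k * \<delta> ^ k)" by simp
  with c(1) have "leads x n (c n)"
    unfolding leads_def filt_def by blast
  then show ?thesis ..
qed

lemma filt_mono:
  assumes "m \<le> n" "x \<in> filt m" shows "x \<in> filt n"
proof -
  obtain c where c: "\<forall>k. c k \<in> M" "x = (\<Sum>k<m. c k * \<delta> ^ k)"
    using assms unfolding filt_def by blast
  have "(\<Sum>k<m. c k * \<delta> ^ k) = (\<Sum>k<n. (if k < m then c k else 0) * \<delta> ^ k)"
    using assms(1) by (intro sum.mono_neutral_cong_left) auto
  then show ?thesis using c unfolding filt_def
    by (intro CollectI exI[of _ "\<lambda>k. if k < m then c k else 0"]) (auto simp: zero_mem)
qed

lemma leads_filt: "leads x n s \<Longrightarrow> x \<in> filt (Suc n)"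
  using filt_add[OF filt_mono[of n "Suc n"] filt_monomial[of s n "Suc n"], of "x - s * \<delta> ^ n"]
  by (simp add: leads_def)

text \<open>Moving \<open>\<delta>\<close> past a coefficient costs a commutator, which lies in
  \<open>M\<close>; so each term gains at most one order.\<close>

lemma filt_delta_mult:
  assumes "x \<in> filt n"
  shows "\<delta> * x \<in> filt (Suc n)"
proof -
  obtain c where c: "\<And>k. c k \<in> M" "x = (\<Sum>k<n. c k * \<delta> ^ k)"
    using assms unfolding filt_def by blast
  \<comment> \<open>Induction over the partial sums, with the target order fixed.\<close>
  have *: "(\<Sum>k<l. \<delta> * (c k * \<delta> ^ k)) \<in> filt (Suc n)" if "l \<le> n" for l
    using that
  proof (induction l)
    case (Suc l)
    have "\<delta> * (c l * \<delta> ^ l) = c l * \<delta> ^ Suc l + (\<delta> * c l - c l * \<delta>) * \<delta> ^ l"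
      by (simp add: algebra_simps)
    also have "\<dots> \<in> filt (Suc n)"
      using Suc.prems by (intro filt_add filt_monomial commutator_mem c) auto
    finally show ?case using Suc by (simp add: filt_add)
  qed (simp add: zero_filt)
  then show ?thesis using c(2) by (simp add: sum_distrib_left)
qed

lemma filt_delta_power_mult: "x \<in> filt n \<Longrightarrow> \<delta> ^ k * x \<in> filt (k + n)"
  by (induction k) (auto simp: mult.assoc intro: filt_delta_mult)

text \<open>Orders at most \<open>k - 1\<close> and \<open>l\<close> add up to at most
  \<open>k + l - 1\<close>; since both bounds of \<open>filt\<close> are strict, one of them needs
  the \<open>Suc\<close>.\<close>

lemma filt_mult:
  assumes "x \<in> filt k" "y \<in> filt (Suc l)"
  shows "x * y \<in> filt (k + l)"
proof -
  obtain c where c: "\<And>k. c k \<in> M" "x = (\<Sum>k<k. c k * \<delta> ^ k)"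
    using assms unfolding filt_def by blast
  have *: "(\<Sum>j<i. c j * \<delta> ^ j * y) \<in> filt (k + l)" if "i \<le> k" for i
    using that
  proof (induction i)
    case (Suc i)
    have "c i * \<delta> ^ i * y \<in> filt (i + Suc l)"
      unfolding mult.assoc by (intro filt_mult_left filt_delta_power_mult c assms)
    then have "c i * \<delta> ^ i * y \<in> filt (k + l)"
      using Suc.prems by (elim filt_mono[rotated]) simp
    with Suc show ?case by (simp add: filt_add)
  qed (simp add: zero_filt)
  then show ?thesis using c(2) by (simp add: sum_distrib_right)
qed

text \<open>Commutators created by moving \<open>t\<close> to the left past
  \<open>\<delta> ^ k\<close> lower the power of \<open>\<delta>\<close>.\<close>

lemma delta_power_leads: "t \<in> M \<Longrightarrow> leads (\<delta> ^ k * t) k t"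
proof (induction k)
  case (Suc k)
  then have IH: "\<delta> ^ k * t - t * \<delta> ^ k \<in> filt k" by (simp add: leads_def)
  have "\<delta> ^ Suc k * t - t * \<delta> ^ Suc k
      = \<delta> * (\<delta> ^ k * t - t * \<delta> ^ k) + (\<delta> * t - t * \<delta>) * \<delta> ^ k"
    by (simp add: algebra_simps)
  also have "\<dots> \<in> filt (Suc k)"
    by (intro filt_add filt_delta_mult IH filt_monomial commutator_mem Suc.prems) simp
  finally show ?case using Suc.prems by (simp add: leads_def)
qed (simp add: leads_def)

lemma mem_leads: "t \<in> M \<Longrightarrow> leads t 0 t"
  by (simp add: leads_def)

lemma monomial_leads: "t \<in> M \<Longrightarrow> leads (t * \<delta> ^ k) k t"
  by (simp add: leads_def zero_filt)

lemma leads_mult: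
  assumes "leads x k s" "leads y l t"
  shows "leads (x * y) (k + l) (s * t)"
proof -
  define r u w where "r = x - s * \<delta> ^ k" and "u = y - t * \<delta> ^ l" and "w = \<delta> ^ k * t - t * \<delta> ^ k"
  have s: "s \<in> M" and t: "t \<in> M" and r: "r \<in> filt k" and u: "u \<in> filt l" and w: "w \<in> filt k"
    using assms delta_power_leads[of t k] by (auto simp: leads_def r_def u_def w_def)
  \<comment> \<open>The three error terms come from the lower part of \<open>x\<close>, the lower
    part of \<open>y\<close>, and the commutator of \<open>\<delta> ^ k\<close> with
    \<open>t\<close>.\<close>
  have "x * y - s * t * \<delta> ^ (k + l) = r * y + s * (\<delta> ^ k * u) + s * (w * \<delta> ^ l)"
    by (simp add: r_def u_def w_def algebra_simps power_add)
  moreover have "\<delta> ^ l \<in> filt (Suc l)"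
    using filt_monomial[OF one_mem, of l "Suc l"] by simp
  then have "w * \<delta> ^ l \<in> filt (k + l)" by (rule filt_mult[OF w])
  ultimately have "x * y - s * t * \<delta> ^ (k + l) \<in> filt (k + l)"
    using filt_mult[OF r leads_filt[OF assms(2)]] filt_delta_power_mult[OF u, of k]
    by (metis filt_add filt_mult_left s)
  then show ?thesis by (simp add: leads_def mult_mem s t)
qed

text \<open>The elimination step of the division: equal leading terms cancel.\<close>

lemma leads_diff:
  assumes "leads x n s" "leads y n s"
  shows "x - y \<in> filt n"
  using filt_diff[of "x - s * \<delta> ^ n" n "y - s * \<delta> ^ n"] assms by (simp add: leads_def)

lemma leads_add_filt:
  assumes "leads x n s" "y \<in> filt n"
  shows "leads (x + y) n s"
  using filt_add[of "x - s * \<delta> ^ n" n y] assms by (simp add: leads_def diff_add_eq)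

text \<open>Induction on the number \<open>m\<close> of orders to remove. If \<open>s\<close> is the
  coefficient of \<open>x\<close> at \<open>\<delta> ^ (j + m)\<close>, then \<open>t * x\<close>
  and \<open>s * \<delta> ^ m * b\<close> have the same leading term, and their difference has
  smaller order.\<close>

lemma pseudo_division_left:
  assumes "leads b j t" "x \<in> filt (j + m)"
  shows "\<exists>c\<in>filt m. \<exists>c'\<in>filt j. t ^ m * x = c * b + c'"
  using assms(2)
proof (induction m arbitrary: x)
  case (Suc m)
  have t: "t \<in> M" using assms(1) by (simp add: leads_def)
  from Suc.prems obtain s where s: "leads x (j + m) s" using filt_Suc_leads by auto
  then have "s \<in> M" by (simp add: leads_def)
  have "leads (t * x) (j + m) (s * t)"
    using leads_mult[OF mem_leads[OF t] s] mem_commute[OF t \<open>s \<in> M\<close>] by simp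
  moreover have "leads (s * \<delta> ^ m * b) (j + m) (s * t)"
    using leads_mult[OF monomial_leads[OF \<open>s \<in> M\<close>] assms(1), of m] by (simp add: add.commute)
  ultimately have "t * x - s * \<delta> ^ m * b \<in> filt (j + m)" by (rule leads_diff)
  from Suc.IH[OF this] obtain c c' where c: "c \<in> filt m" "c' \<in> filt j"
      "t ^ m * (t * x - s * \<delta> ^ m * b) = c * b + c'"
    by blast
  have "t ^ m * s * \<delta> ^ m + c \<in> filt (Suc m)"
    using c(1) by (intro filt_add filt_monomial mult_mem power_mem t \<open>s \<in> M\<close> filt_mono[of m "Suc m" c]) auto
  moreover have "t ^ Suc m * x = (t ^ m * s * \<delta> ^ m + c) * b + c'"
  proof -
    have "t ^ Suc m * x = t ^ m * (t * x)" by (simp only: power_Suc2 mult.assoc)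
    then show ?thesis using c(3) by (simp add: algebra_simps del: power_Suc)
  qed
  ultimately show ?case using c(2) by blast
qed (use zero_filt in auto)

lemma pseudo_division_right:
  assumes "leads b j t" "x \<in> filt (j + m)"
  shows "\<exists>c\<in>filt m. \<exists>c'\<in>filt j. x * t ^ m = b * c + c'"
  using assms(2)
proof (induction m arbitrary: x)
  case (Suc m)
  have t: "t \<in> M" using assms(1) by (simp add: leads_def)
  from Suc.prems obtain s where s: "leads x (j + m) s" using filt_Suc_leads by auto
  then have "s \<in> M" by (simp add: leads_def)
  have "leads (x * t) (j + m) (s * t)"
    using leads_mult[OF s mem_leads[OF t]] by simp
  moreover have "leads (b * (s * \<delta> ^ m)) (j + m) (s * t)"
    using leads_mult[OF assms(1) monomial_leads[OF \<open>s \<in> M\<close>]] mem_commute[OF t \<open>s \<in> M\<close>] by simp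
  ultimately have "x * t - b * (s * \<delta> ^ m) \<in> filt (j + m)" by (rule leads_diff)
  from Suc.IH[OF this] obtain c c' where c: "c \<in> filt m" "c' \<in> filt j"
      "(x * t - b * (s * \<delta> ^ m)) * t ^ m = b * c + c'"
    by blast
  \<comment> \<open>Here \<open>t ^ m\<close> stands to the right of \<open>\<delta> ^ m\<close>, so
    the first summand is not a left monomial; its order comes from multiplicativity of leading
    terms.\<close>
  have "s * \<delta> ^ m * t ^ m + c \<in> filt (Suc m)"
    using c(1) leads_filt[OF leads_mult[OF monomial_leads[OF \<open>s \<in> M\<close>, of m] mem_leads[OF power_mem[OF t, of m]]]]
    by (intro filt_add filt_mono[of m "Suc m" c]) auto
  moreover have "x * t ^ Suc m = b * (s * \<delta> ^ m * t ^ m + c) + c'"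
    using c(3) by (simp add: algebra_simps)
  ultimately show ?case using c(2) by blast
qed (use zero_filt in auto)

text \<open>The first step contributes the multiple of \<open>\<delta> ^ m\<close> to the quotient,
  and pseudo-division adds only terms of order below \<open>m\<close>. Hence the leading coefficient
  of the quotient is explicit.\<close>

lemma common_divisor_division_left:
  assumes "leads a (j + m) (a' * d)" "leads b j (b' * d)" "a' \<in> M" "b' \<in> M" "d \<in> M"
  shows "\<exists>c. \<exists>c'\<in>filt j. leads c m ((b' * d) ^ m * a') \<and> (b' * d) ^ m * b' * a = c * b + c'"
proof -
  let ?t = "b' * d"
  have "b' * (a' * d) = a' * (b' * d)"
    using mem_commute[OF assms(3,4)] by (simp add: mult.assoc[symmetric])
  then have "leads (b' * a) (j + m) (a' * (b' * d))"
    using leads_mult[OF mem_leads[OF assms(4)] assms(1)] by simp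
  moreover have "leads (a' * \<delta> ^ m * b) (j + m) (a' * (b' * d))"
    using leads_mult[OF monomial_leads[OF assms(3)] assms(2), of m] by (simp add: add.commute)
  ultimately have "b' * a - a' * \<delta> ^ m * b \<in> filt (j + m)" by (rule leads_diff)
  from pseudo_division_left[OF assms(2) this] obtain c c' where c: "c \<in> filt m" "c' \<in> filt j"
      "?t ^ m * (b' * a - a' * \<delta> ^ m * b) = c * b + c'"
    by blast
  have "leads (?t ^ m * a' * \<delta> ^ m + c) m (?t ^ m * a')"
    using c(1) by (intro leads_add_filt monomial_leads mult_mem power_mem assms)
  moreover have "?t ^ m * b' * a = (?t ^ m * a' * \<delta> ^ m + c) * b + c'"
    using c(3) by (simp add: algebra_simps)
  ultimately show ?thesis using c(2) by blast
qed

lemma common_divisor_division_right: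
  assumes "leads a (j + m) (a' * d)" "leads b j (b' * d)" "a' \<in> M" "b' \<in> M" "d \<in> M"
  shows "\<exists>c. \<exists>c'\<in>filt j. leads c m (a' * (b' * d) ^ m) \<and> a * (b' * d) ^ m * b' = b * c + c'"
proof -
  let ?t = "b' * d"
  have t: "?t ^ m \<in> M" by (intro power_mem mult_mem assms)
  have "a' * d * b' = b' * d * a'"
    using mem_commute[OF assms(3,4)] mem_commute[OF assms(3,5)] mem_commute[OF assms(4,5)]
    by (metis mult.assoc)
  then have "leads (a * b') (j + m) (b' * d * a')"
    using leads_mult[OF assms(1) mem_leads[OF assms(4)]] by simp
  moreover have "leads (b * (a' * \<delta> ^ m)) (j + m) (b' * d * a')"
    using leads_mult[OF assms(2) monomial_leads[OF assms(3)], of m] by simp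
  ultimately have "a * b' - b * (a' * \<delta> ^ m) \<in> filt (j + m)" by (rule leads_diff)
  from pseudo_division_right[OF assms(2) this] obtain c c' where c: "c \<in> filt m" "c' \<in> filt j"
      "(a * b' - b * (a' * \<delta> ^ m)) * ?t ^ m = b * c + c'"
    by blast
  have "leads (a' * \<delta> ^ m * ?t ^ m + c) m (a' * ?t ^ m)"
    using leads_mult[OF monomial_leads[OF assms(3), of m] mem_leads[OF t]] c(1)
    by (intro leads_add_filt) auto
  \<comment> \<open>The steps produce \<open>b'\<close> before the power of \<open>?t\<close>; both
    lie in the commutative ring \<open>M\<close>, so they may be exchanged.\<close>
  moreover have "a * ?t ^ m * b' = b * (a' * \<delta> ^ m * ?t ^ m + c) + c'"
    using c(3) mem_commute[OF t assms(4)] by (simp add: algebra_simps)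
  ultimately show ?thesis using c(2) by blast
qed

end

text \<open>\<open>independent\<close> expresses left linear independence of the powers of
  \<open>\<delta>\<close> over \<open>M\<close>: \<open>s * \<delta> ^ n\<close> has order below
  \<open>n\<close> only if \<open>s = 0\<close>.\<close>

locale ore_domain = ore_extension +
  assumes independent: "leads 0 n s \<Longrightarrow> s = 0"
    and no_zero_divisors: "x \<in> M \<Longrightarrow> y \<in> M \<Longrightarrow> x * y = 0 \<Longrightarrow> x = 0 \<or> y = 0"
begin

lemma leads_unique_coeff:
  assumes "leads x n s" "leads x n t"
  shows "s = t"
proof -
  have s: "s \<in> M" "x - s * \<delta> ^ n \<in> filt n" and t: "t \<in> M" "x - t * \<delta> ^ n \<in> filt n"
    using assms by (auto simp: leads_def)
  have "0 - (s - t) * \<delta> ^ n = (x - s * \<delta> ^ n) - (x - t * \<delta> ^ n)"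
    by (simp add: left_diff_distrib)
  then have "leads 0 n (s - t)"
    using filt_diff[OF s(2) t(2)] add_mem[OF s(1) uminus_mem[OF t(1)]] by (simp add: leads_def)
  then show ?thesis using independent by fastforce
qed

lemma leads_unique:
  assumes "leads x n s" "leads x m t" "s \<noteq> 0" "t \<noteq> 0"
  shows "n = m \<and> s = t"
proof -
  have less: False if "leads x n s" "leads x m t" "t \<noteq> 0" "n < m" for n m s t
  proof -
    \<comment> \<open>An element of order below \<open>m\<close> has coefficient \<open>0\<close> at
      \<open>\<delta> ^ m\<close>, against \<open>t \<noteq> 0\<close>.\<close>
    have "leads x m 0"
      using filt_mono[OF _ leads_filt[OF that(1)], of m] that(4) by (simp add: leads_def zero_mem)
    then show False using leads_unique_coeff that by blast
  qed
  then have "n = m" using assms by (meson linorder_neqE_nat)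
  then show ?thesis using assms leads_unique_coeff by blast
qed

lemma filt_leads:
  "x \<in> filt n \<Longrightarrow> x \<noteq> 0 \<Longrightarrow> \<exists>k<n. \<exists>s. s \<noteq> 0 \<and> leads x k s"
proof (induction n)
  case (Suc n)
  then obtain s where s: "leads x n s" using filt_Suc_leads by blast
  show ?case
  proof (cases "s = 0")
    case True
    with s have "x \<in> filt n" by (simp add: leads_def)
    with Suc show ?thesis using less_Suc_eq by blast
  qed (use s in blast)
qed simp

lemma power_nonzero: "x \<in> M \<Longrightarrow> x \<noteq> 0 \<Longrightarrow> x ^ n \<noteq> 0"
proof (induction n)
  case 0
  then show ?case by (metis mult.right_neutral mult_zero_right power_0)
next
  case (Suc n)
  then show ?case using no_zero_divisors[of x "x ^ n"] power_mem by auto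
qed

end

subsection \<open>The ring of additive operators\<close>

lemma HsetD:
  assumes "F \<in> Hset"
  shows "F m holomorphic_on UHP" "Im z \<le> 0 \<Longrightarrow> F m z = 0" "finite {n. F n \<noteq> (\<lambda>_. 0)}"
  using assms by (auto simp: Hset_def)

text \<open>Meant for operators that move weights by \<open>w\<close>: the support of
  \<open>G\<close> lies in a translate of the finite support of \<open>F\<close>.\<close>

lemma Hset_shiftI:
  assumes "F \<in> Hset" "\<And>m. G m holomorphic_on UHP" "\<And>m z. Im z \<le> 0 \<Longrightarrow> G m z = 0"
    and "\<And>m. F (m - w) = (\<lambda>_. 0) \<Longrightarrow> G m = (\<lambda>_. 0)"
  shows "G \<in> Hset"
proof -
  have "{m. G m \<noteq> (\<lambda>_. 0)} \<subseteq> (\<lambda>n. n + w) ` {n. F n \<noteq> (\<lambda>_. 0)}"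
    using assms(4) by (force intro: image_eqI[of _ _ "m - w" for m])
  then have "finite {m. G m \<noteq> (\<lambda>_. 0)}"
    using HsetD(3)[OF assms(1)] finite_surj by blast
  with assms show ?thesis by (auto simp: Hset_def)
qed

lemma Hset_zero [simp]: "(\<lambda>_ _. 0) \<in> Hset"
  by (simp add: Hset_def)

lemma Hset_add:
  assumes "F \<in> Hset" "G \<in> Hset"
  shows "(\<lambda>m z. F m z + G m z) \<in> Hset"
proof -
  have "{m. (\<lambda>z. F m z + G m z) \<noteq> (\<lambda>_. 0)} \<subseteq> {n. F n \<noteq> (\<lambda>_. 0)} \<union> {n. G n \<noteq> (\<lambda>_. 0)}"
    by auto
  then have "finite {m. (\<lambda>z. F m z + G m z) \<noteq> (\<lambda>_. 0)}"
    using HsetD(3)[OF assms(1)] HsetD(3)[OF assms(2)] finite_subset by blast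
  with assms show ?thesis by (auto simp: Hset_def intro!: holomorphic_intros)
qed

lemma Hset_cmult: "F \<in> Hset \<Longrightarrow> (\<lambda>m z. c * F m z) \<in> Hset"
  by (rule Hset_shiftI[where w = 0 and F = F]) (auto simp: HsetD intro!: holomorphic_intros)

lemma restrict_UHP_holomorphic:
  "f holomorphic_on UHP \<Longrightarrow> (\<lambda>z. if Im z > 0 then f z else 0) holomorphic_on UHP"
  by (erule holomorphic_transform) (simp add: UHP_def)

lemma Hset_mult:
  assumes "F \<in> Hset" "g holomorphic_on UHP"
  shows "(\<lambda>m z. if Im z > 0 then g z * F (m - w) z else 0) \<in> Hset"
  using assms by (intro Hset_shiftI[where w = w, OF assms(1)] restrict_UHP_holomorphic holomorphic_intros)
    (auto simp: HsetD)

lemma Dk_holomorphic: "f holomorphic_on UHP \<Longrightarrow> Dk k f holomorphic_on UHP"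
  unfolding Dk_def by (intro restrict_UHP_holomorphic holomorphic_intros E_holomorphic) auto

lemma Dk_zero: "Dk k (\<lambda>_. 0) = (\<lambda>_. 0)"
  by (auto simp: Dk_def)

lemma Hset_Dk: "F \<in> Hset \<Longrightarrow> (\<lambda>m. Dk (m - 2) (F (m - 2))) \<in> Hset"
  by (rule Hset_shiftI[where w = 2 and F = F]) (simp_all add: HsetD Dk_zero Dk_holomorphic, simp add: Dk_def)

lemma holomorphic_UHP_differentiable:
  "f holomorphic_on UHP \<Longrightarrow> Im z > 0 \<Longrightarrow> f field_differentiable (at z)"
  using holomorphic_on_imp_differentiable_at[OF _ open_UHP] by (simp add: UHP_def)

lemma Dk_add:
  assumes "f holomorphic_on UHP" "g holomorphic_on UHP"
  shows "Dk k (\<lambda>z. f z + g z) = (\<lambda>z. Dk k f z + Dk k g z)"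
  using assms by (auto simp: Dk_def holomorphic_UHP_differentiable add_divide_distrib ring_distribs)

lemma Dk_cmult:
  assumes "f holomorphic_on UHP"
  shows "Dk k (\<lambda>z. c * f z) = (\<lambda>z. c * Dk k f z)"
  using assms by (auto simp: Dk_def holomorphic_UHP_differentiable ring_distribs)

text \<open>The \<open>E2\<close> term of \<open>Dk\<close> is linear in the weight, so it splits
  between the factors as the weights add. The conditional matches the normalisation of elements of
  \<open>Hset\<close> off the half plane.\<close>

lemma Dk_product:
  assumes "f holomorphic_on UHP" "g holomorphic_on UHP" "Im z > 0"
  shows "Dk (k + l) (\<lambda>z. if Im z > 0 then f z * g z else 0) z = Dk k f z * g z + f z * Dk l g z"
proof -
  have ev: "\<forall>\<^sub>F w in nhds z. Im w > 0"
    using eventually_nhds_in_open[OF open_UHP, of z] assms by (simp add: UHP_def)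
  have "deriv (\<lambda>z. if Im z > 0 then f z * g z else 0) z = deriv (\<lambda>z. f z * g z) z"
    by (rule deriv_cong_ev) (use ev in \<open>auto elim!: eventually_mono\<close>)
  also have "\<dots> = f z * deriv g z + deriv f z * g z"
    using assms by (intro deriv_mult holomorphic_UHP_differentiable)
  finally show ?thesis
    using assms(3) by (simp add: Dk_def field_simps)
qed

definition single :: "real \<Rightarrow> (complex \<Rightarrow> complex) \<Rightarrow> hel" where
  "single k f = (\<lambda>m z. if m = k \<and> Im z > 0 then f z else 0)"

lemma Hset_single:
  assumes "f holomorphic_on UHP" shows "single k f \<in> Hset"
proof -
  have "{m. single k f m \<noteq> (\<lambda>_. 0)} \<subseteq> {k}" by (auto simp: single_def)
  then have "finite {m. single k f m \<noteq> (\<lambda>_. 0)}" using finite_subset by blast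
  moreover have "single k f m holomorphic_on UHP" for m
    using restrict_UHP_holomorphic[OF assms] by (cases "m = k") (auto simp: single_def)
  ultimately show ?thesis by (auto simp: Hset_def single_def)
qed

text \<open>Additivity makes composition distribute over sums on the left. Vanishing outside
  \<open>Hset\<close> turns agreement on \<open>Hset\<close> into equality of functions, and makes
  \<open>scal 1\<close> neutral.\<close>

definition linop :: "rop set" where
  "linop = {T. (\<forall>F. F \<notin> Hset \<longrightarrow> T F = (\<lambda>_ _. 0)) \<and> (\<forall>F\<in>Hset. T F \<in> Hset) \<and>
     (\<forall>F\<in>Hset. \<forall>G\<in>Hset. T (\<lambda>m z. F m z + G m z) = (\<lambda>m z. T F m z + T G m z))}"

lemma linopD:
  assumes "T \<in> linop"
  shows "F \<notin> Hset \<Longrightarrow> T F = (\<lambda>_ _. 0)" "T F \<in> Hset"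
    "F \<in> Hset \<Longrightarrow> G \<in> Hset \<Longrightarrow> T (\<lambda>m z. F m z + G m z) = (\<lambda>m z. T F m z + T G m z)"
proof -
  show "T F \<in> Hset" using assms Hset_zero by (cases "F \<in> Hset") (auto simp: linop_def)
qed (use assms in \<open>auto simp: linop_def\<close>)

lemma linop_vanishes: "T \<in> linop \<Longrightarrow> Im z \<le> 0 \<Longrightarrow> T F m z = 0"
  using HsetD(2)[OF linopD(2)] by blast

lemma linop_restrI:
  assumes "\<And>F. F \<in> Hset \<Longrightarrow> T F \<in> Hset"
    "\<And>F G. F \<in> Hset \<Longrightarrow> G \<in> Hset \<Longrightarrow> T (\<lambda>m z. F m z + G m z) = (\<lambda>m z. T F m z + T G m z)"
  shows "restr T \<in> linop"
  using assms by (auto simp: linop_def restr_def Hset_add)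

lemma scal_linop: "scal c \<in> linop"
  unfolding scal_def by (rule linop_restrI) (auto simp: Hset_cmult ring_distribs)

lemma mulw_linop: "g holomorphic_on UHP \<Longrightarrow> mulw g w \<in> linop"
  unfolding mulw_def by (rule linop_restrI) (auto simp: Hset_mult ring_distribs fun_eq_iff)

lemma delta_linop: "delta \<in> linop"
  unfolding delta_def by (rule linop_restrI) (auto simp: Hset_Dk Dk_add HsetD)

lemma addo_linop: "S \<in> linop \<Longrightarrow> T \<in> linop \<Longrightarrow> addo S T \<in> linop"
  unfolding linop_def addo_def by (auto simp: Hset_add add_ac)

lemma compo_linop: "S \<in> linop \<Longrightarrow> T \<in> linop \<Longrightarrow> compo S T \<in> linop"
  unfolding compo_def by (rule linop_restrI) (auto simp: linopD)

text \<open>A type of class \<open>ring_1\<close>, to which \<open>ore_extension\<close> applies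
  with \<open>addo\<close> and \<open>compo\<close> as ring operations. Negation will be composition
  with \<open>scal (-1)\<close>, so that the closure rules of \<open>Mset\<close> cover it.\<close>

typedef lop = linop
  using scal_linop by blast

setup_lifting type_definition_lop

instantiation lop :: ring_1
begin

lift_definition zero_lop :: lop is "scal 0" by (rule scal_linop)
lift_definition one_lop :: lop is "scal 1" by (rule scal_linop)
lift_definition plus_lop :: "lop \<Rightarrow> lop \<Rightarrow> lop" is addo by (rule addo_linop)
lift_definition times_lop :: "lop \<Rightarrow> lop \<Rightarrow> lop" is compo by (rule compo_linop)
lift_definition uminus_lop :: "lop \<Rightarrow> lop" is "\<lambda>T. compo (scal (-1)) T"
  by (intro compo_linop scal_linop)
lift_definition minus_lop :: "lop \<Rightarrow> lop \<Rightarrow> lop" is "\<lambda>S T. addo S (compo (scal (-1)) T)"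
  by (intro addo_linop compo_linop scal_linop)

instance
proof
  fix x y z :: lop
  show "x + y + z = x + (y + z)"
    by transfer (simp add: addo_def add.assoc)
  show "x + y = y + x"
    by transfer (simp add: addo_def add.commute)
  show "0 + x = x"
    by transfer (auto simp: addo_def scal_def restr_def)
  show "- x + x = 0"
    by transfer (auto simp: addo_def scal_def compo_def restr_def linopD fun_eq_iff)
  show "x - y = x + - y"
    by transfer simp
  show "x * y * z = x * (y * z)"
    by transfer (auto simp: compo_def restr_def linopD fun_eq_iff)
  show "(x + y) * z = x * z + y * z"
    by transfer (auto simp: addo_def compo_def restr_def linopD fun_eq_iff)
  show "x * (y + z) = x * y + x * z"
    by transfer (auto simp: addo_def compo_def restr_def linopD fun_eq_iff)
  show "1 * x = x"
    by transfer (auto simp: scal_def compo_def restr_def linopD fun_eq_iff)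
  show "x * 1 = x"
    by transfer (auto simp: scal_def compo_def restr_def linopD fun_eq_iff)
  show "(0::lop) \<noteq> 1"
  proof (transfer, rule notI)
    let ?F = "single 0 (\<lambda>_. 1)"
    assume "scal 0 = scal 1"
    then have "scal 0 ?F 0 \<i> = scal 1 ?F 0 \<i>" by simp
    moreover have "?F \<in> Hset" by (rule Hset_single) simp
    ultimately show False by (simp add: scal_def restr_def single_def)
  qed
qed

end

lemma lop_eqI:
  assumes "\<And>F m z. F \<in> Hset \<Longrightarrow> Rep_lop x F m z = Rep_lop y F m z"
  shows "x = y"
proof -
  have "Rep_lop x F = Rep_lop y F" for F
    using assms[of F] linopD(1)[OF Rep_lop, of F x] linopD(1)[OF Rep_lop, of F y]
    by (cases "F \<in> Hset") auto
  then show ?thesis by (simp add: Rep_lop_inject[symmetric] fun_eq_iff)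
qed

subsection \<open>Modular forms as operators\<close>

text \<open>
  At a fixed point \<open>z\<close>, an element of \<open>M\<close> acts on the values of a family \<open>F\<close> through a polynomial in the shift of
  the weight by \<open>1\<close>.
\<close>

definition act :: "complex poly \<Rightarrow> (real \<Rightarrow> complex) \<Rightarrow> real \<Rightarrow> complex" where
  "act p \<phi> m = (\<Sum>w\<le>degree p. coeff p w * \<phi> (m - real w))"

lemma act_bound:
  assumes "degree p \<le> N"
  shows "act p \<phi> m = (\<Sum>w\<le>N. coeff p w * \<phi> (m - real w))"
  unfolding act_def using assms
  by (intro sum.mono_neutral_left) (auto simp: coeff_eq_0)

lemma act_0 [simp]: "act 0 \<phi> m = 0"
  by (simp add: act_def)

lemma act_zero_fun [simp]: "act p (\<lambda>_. 0) m = 0"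
  by (simp add: act_def)

lemma act_monom [simp]: "act (monom c n) \<phi> m = c * \<phi> (m - real n)"
proof -
  have "act (monom c n) \<phi> m = (\<Sum>w\<le>n. coeff (monom c n) w * \<phi> (m - real w))"
    by (rule act_bound) (rule degree_monom_le)
  also have "\<dots> = (\<Sum>w\<le>n. if w = n then c * \<phi> (m - real n) else 0)"
    by (rule sum.cong) auto
  finally show ?thesis by simp
qed

lemma act_add: "act (p + q) \<phi> m = act p \<phi> m + act q \<phi> m"
  by (simp add: act_bound[of p "max (degree p) (degree q)"] act_bound[of q "max (degree p) (degree q)"]
      act_bound[OF degree_add_le_max] ring_distribs sum.distrib)

lemma act_smult: "act (smult c p) \<phi> m = c * act p \<phi> m"
  by (simp add: act_bound[OF degree_smult_le] act_def sum_distrib_left mult.assoc)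

lemma act_pCons: "act (pCons c p) \<phi> m = c * \<phi> m + act p \<phi> (m - 1)"
proof -
  have "act (pCons c p) \<phi> m = (\<Sum>w\<le>Suc (degree p). coeff (pCons c p) w * \<phi> (m - real w))"
    by (rule act_bound) (simp add: degree_pCons_le)
  also have "\<dots> = c * \<phi> m + (\<Sum>w\<le>degree p. coeff p w * \<phi> (m - real (Suc w)))"
    by (subst sum.atMost_Suc_shift) simp
  finally show ?thesis by (simp add: act_def algebra_simps)
qed

text \<open>\<open>act\<close> is an action of the polynomial ring, in which the variable sends
  \<open>\<phi> m\<close> to \<open>\<phi> (m - 1)\<close>.\<close>

lemma act_mult: "act (p * q) \<phi> m = act p (act q \<phi>) m"
  by (induction p arbitrary: m) (simp_all add: act_add act_smult act_pCons)

text \<open>Acting on a family concentrated in one weight reads off a single coefficient; this makes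
  the polynomial representation faithful.\<close>

lemma act_delta_fun: "act p (\<lambda>m. if m = k then c else 0) (k + real n) = coeff p n * c"
proof -
  have "act p (\<lambda>m. if m = k then c else 0) (k + real n)
      = (\<Sum>w\<le>max n (degree p). coeff p w * (if k + real n - real w = k then c else 0))"
    by (rule act_bound) simp
  also have "\<dots> = (\<Sum>w\<le>max n (degree p). if w = n then coeff p w * c else 0)"
    by (rule sum.cong) auto
  finally show ?thesis by simp
qed

text \<open>The coefficient of index \<open>w\<close> in \<open>p z\<close> is the value at
  \<open>z\<close> of the weight \<open>w\<close> component. Only natural weights occur, since the
  generators have weights 0, 4 and 6. Composition becomes multiplication of polynomials.\<close>

definition polyrep :: "rop \<Rightarrow> (complex \<Rightarrow> complex poly) \<Rightarrow> bool" where
  "polyrep T p \<longleftrightarrow> T \<in> linop \<and> (\<forall>w. (\<lambda>z. coeff (p z) w) holomorphic_on UHP) \<and>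
     (\<forall>F\<in>Hset. \<forall>m z. Im z > 0 \<longrightarrow> T F m z = act (p z) (\<lambda>m. F m z) m)"

lemma polyrepD:
  assumes "polyrep T p"
  shows "T \<in> linop" "(\<lambda>z. coeff (p z) w) holomorphic_on UHP"
    "F \<in> Hset \<Longrightarrow> Im z > 0 \<Longrightarrow> T F m z = act (p z) (\<lambda>m. F m z) m"
  using assms by (auto simp: polyrep_def)

lemma polyrep_mulw:
  assumes "g holomorphic_on UHP"
  shows "polyrep (mulw g (real n)) (\<lambda>z. monom (g z) n)"
proof -
  have "(\<lambda>z. coeff (monom (g z) n) w) holomorphic_on UHP" for w
    using assms by (cases "n = w") auto
  then show ?thesis
    using assms by (auto simp: polyrep_def mulw_linop) (simp add: mulw_def restr_def)
qed

lemma polyrep_scal: "polyrep (scal c) (\<lambda>z. monom c 0)"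
  by (auto simp: polyrep_def scal_linop) (auto simp: scal_def restr_def coeff_monom)

lemma polyrep_add: "polyrep S p \<Longrightarrow> polyrep T q \<Longrightarrow> polyrep (addo S T) (\<lambda>z. p z + q z)"
  unfolding polyrep_def by (auto simp: addo_linop act_add intro!: holomorphic_intros) (simp add: addo_def)

lemma polyrep_comp:
  assumes "polyrep S p" "polyrep T q"
  shows "polyrep (compo S T) (\<lambda>z. p z * q z)"
proof -
  have "(\<lambda>z. coeff (p z * q z) w) holomorphic_on UHP" for w
    unfolding coeff_mult by (intro holomorphic_intros polyrepD[OF assms(1)] polyrepD[OF assms(2)])
  moreover have "compo S T F m z = act (p z * q z) (\<lambda>m. F m z) m" if "F \<in> Hset" "Im z > 0" for F m z
  proof -
    have "compo S T F m z = act (p z) (\<lambda>m. T F m z) m"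
      using that polyrepD[OF assms(1)] polyrepD(1)[OF assms(2)] by (simp add: compo_def restr_def linopD)
    also have "(\<lambda>m. T F m z) = act (q z) (\<lambda>m. F m z)"
      using that polyrepD[OF assms(2)] by auto
    finally show ?thesis by (simp add: act_mult)
  qed
  ultimately show ?thesis
    using assms by (auto simp: polyrep_def compo_linop)
qed

lemma Mset_polyrep: "a \<in> Mset \<Longrightarrow> \<exists>p. polyrep a p"
proof (induction rule: Mset.induct)
  case M_e4
  show ?case using polyrep_mulw[OF E_holomorphic(2), of 4] by (auto simp: e4_def)
next
  case M_e6
  show ?case using polyrep_mulw[OF E_holomorphic(3), of 6] by (auto simp: e6_def)
qed (blast intro: polyrep_scal polyrep_add polyrep_comp)+

lemma polyrep_eqI:
  assumes "polyrep S p" "polyrep T q" "\<And>z. Im z > 0 \<Longrightarrow> p z = q z"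
  shows "S = T"
proof (intro ext)
  fix F m z
  note S = linopD[OF polyrepD(1)[OF assms(1)]] and T = linopD[OF polyrepD(1)[OF assms(2)]]
  show "S F m z = T F m z"
  proof (cases "F \<in> Hset \<and> Im z > 0")
    case True
    then show ?thesis using assms by (simp add: polyrepD)
  next
    case False
    then show ?thesis using S(1)[of F] T(1)[of F] HsetD(2)[OF S(2)] HsetD(2)[OF T(2)] by auto
  qed
qed

lemma polyrep_unique:
  assumes "polyrep T p" "polyrep T q" "Im z > 0"
  shows "p z = q z"
proof (rule poly_eqI)
  fix n
  let ?F = "single 0 (\<lambda>_. 1)"
  have F: "?F \<in> Hset" by (rule Hset_single) simp
  have eq: "(\<lambda>m. ?F m z) = (\<lambda>m. if m = 0 then 1 else 0)"
    using assms(3) by (auto simp: single_def)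
  have "act (p z) (\<lambda>m. ?F m z) (0 + real n) = act (q z) (\<lambda>m. ?F m z) (0 + real n)"
    using polyrepD(3)[OF assms(1) F assms(3)] polyrepD(3)[OF assms(2) F assms(3)] by metis
  then show "coeff (p z) n = coeff (q z) n"
    unfolding eq act_delta_fun by simp
qed

lemma polyrep_eq_zero_iff: "polyrep T p \<Longrightarrow> T = scal 0 \<longleftrightarrow> (\<forall>z. Im z > 0 \<longrightarrow> p z = 0)"
  using polyrep_unique[of T p "\<lambda>z. monom 0 0"] polyrep_eqI[of T p "scal 0" "\<lambda>z. monom 0 0"] polyrep_scal[of 0]
  by auto

lemma Mset_commute:
  assumes "a \<in> Mset" "b \<in> Mset"
  shows "compo a b = compo b a"
proof -
  obtain p q where p: "polyrep a p" and q: "polyrep b q" using assms Mset_polyrep by blast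
  show ?thesis
    by (rule polyrep_eqI[OF polyrep_comp[OF p q] polyrep_comp[OF q p]]) (simp add: mult.commute)
qed

text \<open>At each \<open>z\<close> one of \<open>p z\<close>, \<open>q z\<close> vanishes, but
  which one could depend on \<open>z\<close>. Some coefficient of \<open>q\<close> is nonzero on a
  nonempty open set; there \<open>p z = 0\<close>, and the identity theorem extends this to all of
  \<open>UHP\<close>.\<close>

lemma Mset_no_zero_divisors:
  assumes "a \<in> Mset" "b \<in> Mset" "compo a b = scal 0"
  shows "a = scal 0 \<or> b = scal 0"
proof (rule disjCI)
  obtain p q where p: "polyrep a p" and q: "polyrep b q" using assms Mset_polyrep by blast
  have pq: "p z = 0 \<or> q z = 0" if "Im z > 0" for z
    using polyrep_eq_zero_iff[OF polyrep_comp[OF p q]] assms(3) that by simp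
  assume "b \<noteq> scal 0"
  then obtain z0 where z0: "Im z0 > 0" "q z0 \<noteq> 0"
    using polyrep_eq_zero_iff[OF q] by auto
  then obtain n where n: "coeff (q z0) n \<noteq> 0" by (auto simp: poly_eq_iff)
  have "continuous_on UHP (\<lambda>z. coeff (q z) n)"
    using polyrepD(2)[OF q] holomorphic_on_imp_continuous_on by blast
  then have op: "open (UHP \<inter> (\<lambda>z. coeff (q z) n) -` (- {0}))"
    by (intro continuous_open_preimage) auto
  show "a = scal 0"
    unfolding polyrep_eq_zero_iff[OF p]
  proof (intro allI impI poly_eqI)
    fix z w assume "Im z > 0"
    show "coeff (p z) w = coeff 0 w" unfolding coeff_0
    proof (rule analytic_continuation_open[where f = "\<lambda>z. coeff (p z) w" and g = "\<lambda>_. 0",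
          OF op open_UHP _ connected_UHP])
      show "UHP \<inter> (\<lambda>z. coeff (q z) n) -` (- {0}) \<noteq> {}"
        using z0 n by (auto simp: UHP_def)
      show "coeff (p z) w = 0" if "z \<in> UHP \<inter> (\<lambda>z. coeff (q z) n) -` (- {0})" for z
        using that pq[of z] by (auto simp: UHP_def)
    qed (use \<open>Im z > 0\<close> polyrepD(2)[OF p] in \<open>auto simp: UHP_def\<close>)
  qed
qed

subsection \<open>Commutation with \<open>\<delta>\<close>\<close>

lift_definition lop_delta :: lop is delta by (rule delta_linop)
lift_definition lop_e4 :: lop is e4 unfolding e4_def by (intro mulw_linop E_holomorphic)
lift_definition lop_e6 :: lop is e6 unfolding e6_def by (intro mulw_linop E_holomorphic)
lift_definition lop_scal :: "complex \<Rightarrow> lop" is scal by (rule scal_linop)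

definition Mlop :: "lop set" where "Mlop = {x. Rep_lop x \<in> Mset}"
definition Rlop :: "lop set" where "Rlop = {x. Rep_lop x \<in> Rset}"

lemma Mlop_intros:
  "lop_e4 \<in> Mlop" "lop_e6 \<in> Mlop" "lop_scal c \<in> Mlop" "0 \<in> Mlop" "1 \<in> Mlop"
  "x \<in> Mlop \<Longrightarrow> y \<in> Mlop \<Longrightarrow> x + y \<in> Mlop" "x \<in> Mlop \<Longrightarrow> y \<in> Mlop \<Longrightarrow> x * y \<in> Mlop"
  "x \<in> Mlop \<Longrightarrow> - x \<in> Mlop"
  by (simp_all add: Mlop_def lop_e4.rep_eq lop_e6.rep_eq lop_scal.rep_eq zero_lop.rep_eq one_lop.rep_eq
      plus_lop.rep_eq times_lop.rep_eq uminus_lop.rep_eq Mset.intros)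

lemma Rlop_intros:
  "lop_delta \<in> Rlop" "1 \<in> Rlop" "0 \<in> Rlop"
  "x \<in> Rlop \<Longrightarrow> y \<in> Rlop \<Longrightarrow> x + y \<in> Rlop" "x \<in> Rlop \<Longrightarrow> y \<in> Rlop \<Longrightarrow> x * y \<in> Rlop"
  by (simp_all add: Rlop_def lop_delta.rep_eq zero_lop.rep_eq one_lop.rep_eq
      plus_lop.rep_eq times_lop.rep_eq Rset.intros)

lemma Mset_subset_Rset: "a \<in> Mset \<Longrightarrow> a \<in> Rset"
  by (induction rule: Mset.induct) (auto intro: Rset.intros)

lemma Mlop_subset_Rlop: "x \<in> Mlop \<Longrightarrow> x \<in> Rlop"
  by (simp add: Mlop_def Rlop_def Mset_subset_Rset)

lemma Mlop_induct [consumes 1, case_names e4 e6 scal add mult]: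
  assumes "x \<in> Mlop" "P lop_e4" "P lop_e6" "\<And>c. P (lop_scal c)"
    "\<And>x y. x \<in> Mlop \<Longrightarrow> y \<in> Mlop \<Longrightarrow> P x \<Longrightarrow> P y \<Longrightarrow> P (x + y)"
    "\<And>x y. x \<in> Mlop \<Longrightarrow> y \<in> Mlop \<Longrightarrow> P x \<Longrightarrow> P y \<Longrightarrow> P (x * y)"
  shows "P x"
proof -
  have "\<exists>y\<in>Mlop. Rep_lop y = a \<and> P y" if "a \<in> Mset" for a
    using that
  proof (induction rule: Mset.induct)
    case (M_add a b)
    then show ?case using assms(5) by (metis Mlop_intros(6) plus_lop.rep_eq)
  next
    case (M_comp a b)
    then show ?case using assms(6) by (metis Mlop_intros(7) times_lop.rep_eq)
  qed (metis assms(2-4) Mlop_intros(1-3) lop_e4.rep_eq lop_e6.rep_eq lop_scal.rep_eq)+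
  then show ?thesis using assms(1) by (metis Mlop_def Rep_lop_inject mem_Collect_eq)
qed

lemma Rlop_induct [consumes 1, case_names delta mem add mult]:
  assumes "x \<in> Rlop" "P lop_delta" "\<And>x. x \<in> Mlop \<Longrightarrow> P x"
    "\<And>x y. P x \<Longrightarrow> P y \<Longrightarrow> P (x + y)" "\<And>x y. P x \<Longrightarrow> P y \<Longrightarrow> P (x * y)"
  shows "P x"
proof -
  have "\<exists>y. Rep_lop y = a \<and> P y" if "a \<in> Rset" for a
    using that
  proof (induction rule: Rset.induct)
    case (R_add a b)
    then show ?case using assms(4) by (metis plus_lop.rep_eq)
  next
    case (R_comp a b)
    then show ?case using assms(5) by (metis times_lop.rep_eq)
  qed (metis assms(2,3) Mlop_intros(1-3) lop_e4.rep_eq lop_e6.rep_eq lop_scal.rep_eq lop_delta.rep_eq)+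
  then show ?thesis using assms(1) by (metis Rlop_def Rep_lop_inject mem_Collect_eq)
qed

lemma on_Hset:
  assumes "F \<in> Hset"
  shows "compo a b F = a (b F)" "delta F = (\<lambda>m. Dk (m - 2) (F (m - 2)))" "scal c F = (\<lambda>m z. c * F m z)"
    "mulw g w F = (\<lambda>m z. if Im z > 0 then g z * F (m - w) z else 0)"
  using assms by (simp_all add: compo_def delta_def scal_def mulw_def restr_def)

text \<open>The Leibniz rule for \<open>Dk\<close> in operator form: commuting \<open>delta\<close>
  with multiplication by \<open>g\<close> gives multiplication by \<open>Dk w g\<close>, in weight
  \<open>w + 2\<close>.\<close>

lemma delta_mulw_commutator:
  assumes "g holomorphic_on UHP" "h holomorphic_on UHP" "\<And>z. Im z > 0 \<Longrightarrow> Dk w g z = c * h z" "F \<in> Hset"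
  shows "compo delta (mulw g w) F m z = compo (mulw g w) delta F m z + compo (scal c) (mulw h (w + 2)) F m z"
proof (cases "Im z > 0")
  case True
  let ?f = "F (m - 2 - w)"
  have mem: "mulw g w F \<in> Hset" "delta F \<in> Hset" "mulw h (w + 2) F \<in> Hset"
    using assms mulw_linop delta_linop linopD(2) by blast+
  \<comment> \<open>The weight \<open>m - 2\<close> on which \<open>delta\<close> acts is written as
    \<open>w + (m - 2 - w)\<close>, the weights of the two factors.\<close>
  have "compo delta (mulw g w) F m z
      = Dk (w + (m - 2 - w)) (\<lambda>z. if Im z > 0 then g z * ?f z else 0) z"
    by (simp add: on_Hset(1,2) mem assms(4)) (simp add: on_Hset(4) assms(4))
  also have "\<dots> = Dk w g z * ?f z + g z * Dk (m - 2 - w) ?f z"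
    by (rule Dk_product) (use assms True HsetD in auto)
  also have "\<dots> = compo (mulw g w) delta F m z + compo (scal c) (mulw h (w + 2)) F m z"
    using True assms(3)
    unfolding on_Hset(1)[OF assms(4)]
    unfolding on_Hset(4)[OF mem(2)] on_Hset(3)[OF mem(3)]
    unfolding on_Hset(2,4)[OF assms(4)]
    by (simp add: algebra_simps)
  finally show ?thesis .
next
  case False
  have "compo delta (mulw g w) \<in> linop" "compo (mulw g w) delta \<in> linop"
      "compo (scal c) (mulw h (w + 2)) \<in> linop"
    by (intro compo_linop delta_linop mulw_linop scal_linop assms)+
  from this[THEN linop_vanishes, of z F m] False show ?thesis by simp
qed

lemma Dk_E4: "Im z > 0 \<Longrightarrow> Dk 4 E4 z = (-1/3) * E6 z"
  by (simp add: Dk_def ramanujan_E4_E6) (simp add: field_simps)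

lemma Dk_E6: "Im z > 0 \<Longrightarrow> Dk 6 E6 z = (-1/2) * (E4 z * E4 z)"
  by (simp add: Dk_def ramanujan_E4_E6) (simp add: field_simps)

lemma delta_e4_commutator: "lop_delta * lop_e4 - lop_e4 * lop_delta = lop_scal (-1/3) * lop_e6"
proof -
  have "lop_delta * lop_e4 = lop_e4 * lop_delta + lop_scal (-1/3) * lop_e6"
    by (rule lop_eqI)
      (use delta_mulw_commutator[OF E_holomorphic(2,3) Dk_E4] in
        \<open>simp add: plus_lop.rep_eq times_lop.rep_eq lop_delta.rep_eq lop_e4.rep_eq lop_e6.rep_eq lop_scal.rep_eq
          addo_def e4_def e6_def\<close>)
  then show ?thesis by simp
qed

lemma delta_e6_commutator:
  "lop_delta * lop_e6 - lop_e6 * lop_delta = lop_scal (-1/2) * (lop_e4 * lop_e4)"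
proof -
  have "(\<lambda>z. E4 z * E4 z) holomorphic_on UHP" by (intro holomorphic_intros E_holomorphic)
  note * = delta_mulw_commutator[OF E_holomorphic(3) this Dk_E6]
  \<comment> \<open>The commutator is a multiplication operator of weight \<open>6 + 2\<close>; it
    has to be recognised as an element generated by \<open>e4\<close>.\<close>
  have "mulw (\<lambda>z. E4 z * E4 z) 8 F = compo e4 e4 F" if "F \<in> Hset" for F
    using that linopD(2)[OF mulw_linop[OF E_holomorphic(2), of 4], of F]
    by (auto simp: compo_def restr_def e4_def mulw_def fun_eq_iff algebra_simps)
  then have "compo (scal c) (mulw (\<lambda>z. E4 z * E4 z) 8) F = compo (scal c) (compo e4 e4) F" if "F \<in> Hset" for F c
    using that by (simp add: compo_def[of "scal c"] restr_def)
  then have "lop_delta * lop_e6 = lop_e6 * lop_delta + lop_scal (-1/2) * (lop_e4 * lop_e4)"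
    using *
    by (intro lop_eqI)
       (simp add: plus_lop.rep_eq times_lop.rep_eq lop_delta.rep_eq lop_e4.rep_eq lop_e6.rep_eq lop_scal.rep_eq
          addo_def e6_def)
  then show ?thesis by simp
qed

lemma delta_scal_commute: "lop_delta * lop_scal c = lop_scal c * lop_delta"
  by (rule lop_eqI)
     (auto simp: times_lop.rep_eq lop_delta.rep_eq lop_scal.rep_eq compo_def restr_def scal_def delta_def
       Hset_cmult Hset_Dk Dk_cmult HsetD)

text \<open>Commutation is a derivation, so the generators decide; for \<open>e4\<close> and
  \<open>e6\<close> these are Ramanujan's identities, and scalars commute with
  \<open>delta\<close>.\<close>

lemma Mlop_commutator: "x \<in> Mlop \<Longrightarrow> lop_delta * x - x * lop_delta \<in> Mlop"
proof (induction rule: Mlop_induct)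
  case e4
  then show ?case by (simp add: delta_e4_commutator Mlop_intros)
next
  case e6
  then show ?case by (simp add: delta_e6_commutator Mlop_intros)
next
  case (scal c)
  then show ?case by (simp add: delta_scal_commute Mlop_intros)
next
  case (add x y)
  then have "(lop_delta * x - x * lop_delta) + (lop_delta * y - y * lop_delta) \<in> Mlop"
    by (intro Mlop_intros)
  then show ?case by (simp add: algebra_simps)
next
  case (mult x y)
  then have "(lop_delta * x - x * lop_delta) * y + x * (lop_delta * y - y * lop_delta) \<in> Mlop"
    by (intro Mlop_intros)
  then show ?case by (simp add: algebra_simps)
qed

interpretation R: ore_extension Mlop lop_delta
proof
  show "x * y = y * x" if "x \<in> Mlop" "y \<in> Mlop" for x y
    using that Mset_commute[of "Rep_lop x" "Rep_lop y"]
    by (simp add: Mlop_def Rep_lop_inject[symmetric] times_lop.rep_eq)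
qed (simp_all add: Mlop_intros Mlop_commutator)

subsection \<open>Uniqueness of expressions in \<open>\<delta>\<close>\<close>

lemma delta_single:
  assumes "g holomorphic_on UHP"
  shows "delta (single k g) = single (k + 2) (Dk k g)"
proof (intro ext)
  fix m z
  have "Dk k (single k g k) z = Dk k g z" if "Im z > 0"
  proof -
    have ev: "\<forall>\<^sub>F w in nhds z. Im w > 0"
      using eventually_nhds_in_open[OF open_UHP, of z] that by (simp add: UHP_def)
    have "deriv (single k g k) z = deriv g z"
      by (rule deriv_cong_ev) (use ev in \<open>auto elim!: eventually_mono simp: single_def\<close>)
    then show ?thesis by (simp add: Dk_def single_def)
  qed
  moreover have "Dk (m - 2) (single k g (m - 2)) z = 0" if "m - 2 \<noteq> k"
    using that by (simp add: Dk_def single_def)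
  ultimately show "delta (single k g) m z = single (k + 2) (Dk k g) m z"
    unfolding on_Hset(2)[OF Hset_single[OF assms]]
    by (cases "m - 2 = k") (auto simp: single_def Dk_def)
qed

text \<open>The order of vanishing at \<open>z\<^sub>0\<close> drops by exactly one with each application of \<open>\<delta>\<close>.\<close>

lemma delta_power_single:
  assumes "Im z0 > 0" "k \<le> n"
  shows "\<exists>h. h holomorphic_on UHP \<and> h z0 \<noteq> 0 \<and>
    Rep_lop (lop_delta ^ k) (single 0 (\<lambda>z. (z - z0) ^ n)) = single (2 * real k) (\<lambda>z. (z - z0) ^ (n - k) * h z)"
  using assms(2)
proof (induction k)
  case 0
  have "single 0 (\<lambda>z. (z - z0) ^ n) \<in> Hset" by (intro Hset_single holomorphic_intros)
  then show ?case
    by (intro exI[of _ "\<lambda>_. 1"]) (simp add: one_lop.rep_eq on_Hset)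
next
  case (Suc k)
  then obtain h where h: "h holomorphic_on UHP" "h z0 \<noteq> 0"
    "Rep_lop (lop_delta ^ k) (single 0 (\<lambda>z. (z - z0) ^ n)) = single (2 * real k) (\<lambda>z. (z - z0) ^ (n - k) * h z)"
    by auto
  define j where "j = n - Suc k"
  have j: "n - k = Suc j" using Suc.prems by (simp add: j_def)
  \<comment> \<open>The cofactor left after taking \<open>(z - z0) ^ j\<close> out of the
    derivative. At \<open>z0\<close> only
    \<open>of_nat (Suc j) * h z0 / (2 * of_real pi * \<i>)\<close> survives, since the
    \<open>E2\<close> term carries an extra factor \<open>z - z0\<close>.\<close>
  define h' where "h' = (\<lambda>z. (of_nat (Suc j) * h z + (z - z0) * deriv h z) / (2 * of_real pi * \<i>)
     - of_real (2 * real k / 12) * E2 z * (z - z0) * h z)"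
  have "h' holomorphic_on UHP"
    unfolding h'_def by (intro holomorphic_intros h E_holomorphic) auto
  moreover have "h' z0 \<noteq> 0" using h(2) by (simp add: h'_def del: of_nat_Suc)
  moreover have hol: "(\<lambda>z. (z - z0) ^ Suc j * h z) holomorphic_on UHP" by (intro holomorphic_intros h)
  have "Dk (2 * real k) (\<lambda>z. (z - z0) ^ Suc j * h z) z = (z - z0) ^ j * h' z" if "Im z > 0" for z
  proof -
    have "(h has_field_derivative deriv h z) (at z)"
      using holomorphic_UHP_differentiable[OF h(1) that] by (simp add: DERIV_deriv_iff_field_differentiable)
    then have "((\<lambda>z. (z - z0) ^ Suc j * h z) has_field_derivative
        of_nat (Suc j) * (z - z0) ^ j * h z + (z - z0) ^ Suc j * deriv h z) (at z)"
      by (auto intro!: derivative_eq_intros simp del: power_Suc)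
    then show ?thesis
      using that by (simp add: Dk_def DERIV_imp_deriv h'_def field_simps)
  qed
  then have "single (2 * real k + 2) (Dk (2 * real k) (\<lambda>z. (z - z0) ^ Suc j * h z))
      = single (2 * real (Suc k)) (\<lambda>z. (z - z0) ^ (n - Suc k) * h' z)"
    by (auto simp: single_def fun_eq_iff j_def)
  moreover have "Rep_lop (lop_delta ^ Suc k) (single 0 (\<lambda>z. (z - z0) ^ n))
      = single (2 * real k + 2) (Dk (2 * real k) (\<lambda>z. (z - z0) ^ Suc j * h z))"
  proof -
    have "single 0 (\<lambda>z. (z - z0) ^ n) \<in> Hset" by (intro Hset_single holomorphic_intros)
    then show ?thesis
      by (simp only: power_Suc[of lop_delta] times_lop.rep_eq lop_delta.rep_eq on_Hset(1) h(3) j delta_single[OF hol])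
  qed
  ultimately show ?case by metis
qed

lemma Rep_lop_sum:
  "finite A \<Longrightarrow> Rep_lop (sum f A) F m z = (\<Sum>k\<in>A. Rep_lop (f k) F m z)"
proof (induction rule: finite_induct)
  case empty
  then show ?case by (simp add: zero_lop.rep_eq scal_def restr_def)
qed (simp add: plus_lop.rep_eq addo_def)

lemma Mlop_polyrep: "x \<in> Mlop \<Longrightarrow> \<exists>p. polyrep (Rep_lop x) p"
  using Mset_polyrep by (simp add: Mlop_def)

text \<open>The test function has its zero of order \<open>n\<close> at the evaluation point
  \<open>z\<close> itself: lower powers of \<open>delta\<close> still vanish there, the power
  \<open>n\<close> does not. This isolates the coefficients of \<open>p z\<close>, and
  \<open>z\<close> is arbitrary.\<close>

lemma delta_powers_independent:
  assumes "R.leads 0 n s"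
  shows "s = 0"
proof -
  from assms obtain c where s: "s \<in> Mlop" and c: "\<forall>k. c k \<in> Mlop"
    and sum: "0 - s * lop_delta ^ n = (\<Sum>k<n. c k * lop_delta ^ k)"
    unfolding R.leads_def R.filt_def by blast
  obtain p where p: "polyrep (Rep_lop s) p" using Mlop_polyrep[OF s] by blast
  have zero: "0 = s * lop_delta ^ n + (\<Sum>k<n. c k * lop_delta ^ k)"
    using sum by (metis add.commute diff_add_cancel)
  have "p z = 0" if z: "Im z > 0" for z
  proof (rule poly_eqI)
    fix w
    define F where "F = single 0 (\<lambda>u. (u - z) ^ n)"
    \<comment> \<open>\<open>delta\<close> applied \<open>n\<close> times moves weight 0 to
      \<open>2 * n\<close>; the coefficient of index \<open>w\<close> moves it by a further
      \<open>w\<close>.\<close>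
    let ?m = "2 * real n + real w"
    have F: "F \<in> Hset" unfolding F_def by (intro Hset_single holomorphic_intros)
    have dF: "Rep_lop (lop_delta ^ k) F \<in> Hset" for k by (rule linopD(2)[OF Rep_lop])
    have comp: "Rep_lop (x * lop_delta ^ k) F ?m z = act (q z) (\<lambda>m. Rep_lop (lop_delta ^ k) F m z) ?m"
      if "polyrep (Rep_lop x) q" for x q k
      using polyrepD(3)[OF that dF z] by (simp add: times_lop.rep_eq on_Hset F)
    have "Rep_lop (c k * lop_delta ^ k) F ?m z = 0" if "k < n" for k
    proof -
      obtain q where q: "polyrep (Rep_lop (c k)) q" using c Mlop_polyrep by blast
      have "(\<lambda>m. Rep_lop (lop_delta ^ k) F m z) = (\<lambda>_. 0)"
        using delta_power_single[OF z, of k n] that by (auto simp: F_def single_def)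
      then show ?thesis using comp[OF q, of k] by simp
    qed
    then have "Rep_lop (s * lop_delta ^ n) F ?m z = Rep_lop 0 F ?m z"
      by (subst zero) (simp add: plus_lop.rep_eq addo_def Rep_lop_sum)
    also have "\<dots> = 0" by (simp add: zero_lop.rep_eq on_Hset F)
    finally have "act (p z) (\<lambda>m. Rep_lop (lop_delta ^ n) F m z) ?m = 0"
      by (simp add: comp[OF p])
    moreover obtain h where "h z \<noteq> 0" "(\<lambda>m. Rep_lop (lop_delta ^ n) F m z) = (\<lambda>m. if m = 2 * real n then h z else 0)"
      using delta_power_single[OF z, of n n] z by (auto simp: F_def single_def)
    ultimately show "coeff (p z) w = coeff 0 w"
      by (simp add: act_delta_fun)
  qed
  then have "Rep_lop s = scal 0" using polyrep_eq_zero_iff[OF p] by simp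
  then show ?thesis by (simp add: Rep_lop_inject[symmetric] zero_lop.rep_eq)
qed

interpretation R: ore_domain Mlop lop_delta
proof
  show "x = 0 \<or> y = 0" if "x \<in> Mlop" "y \<in> Mlop" "x * y = 0" for x y
    using that Mset_no_zero_divisors[of "Rep_lop x" "Rep_lop y"]
    by (simp add: Mlop_def Rep_lop_inject[symmetric] times_lop.rep_eq zero_lop.rep_eq)
qed (rule delta_powers_independent)

section \<open>From leading terms back to \<open>dexpr\<close>, \<open>ord\<close> and
  \<open>top\<close>\<close>

lemma Rep_lop_power: "Rep_lop (x ^ k) = opow (Rep_lop x) k"
  by (induction k) (simp_all add: one_lop.rep_eq times_lop.rep_eq)

lemma Rep_lop_osum: "Rep_lop (\<Sum>k\<le>n. c k * lop_delta ^ k) = osum (\<lambda>k. Rep_lop (c k)) n"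
proof (induction n)
  case 0
  have "Rep_lop (c 0 * lop_delta ^ 0) = compo (Rep_lop (c 0)) (opow delta 0)"
    by (simp only: times_lop.rep_eq Rep_lop_power lop_delta.rep_eq)
  then show ?case by simp
next
  case (Suc n)
  have "Rep_lop (c (Suc n) * lop_delta ^ Suc n) = compo (Rep_lop (c (Suc n))) (opow delta (Suc n))"
    by (simp only: times_lop.rep_eq Rep_lop_power lop_delta.rep_eq)
  then show ?case by (simp only: sum.atMost_Suc plus_lop.rep_eq Suc osum.simps)
qed

lemma osum_cong: "(\<And>k. k \<le> n \<Longrightarrow> c k = d k) \<Longrightarrow> osum c n = osum d n"
  by (induction n) auto

lemma dexpr_leads:
  assumes "dexpr (Rep_lop x) n cs"
  shows "\<exists>s. Rep_lop s = cs n \<and> s \<noteq> 0 \<and> R.leads x n s"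
proof -
  \<comment> \<open>\<open>dexpr\<close> says nothing about \<open>cs\<close> above
    \<open>n\<close>, whereas \<open>filt\<close> asks for all coefficients to lie in
    \<open>Mlop\<close>; hence the default \<open>0\<close>.\<close>
  define c where "c = (\<lambda>k. if k \<le> n then Abs_lop (cs k) else 0)"
  have cs: "cs k \<in> Mset" if "k \<le> n" for k using assms that by (simp add: dexpr_def)
  have Rep_c: "Rep_lop (c k) = cs k" if "k \<le> n" for k
    using Mset_polyrep[OF cs[OF that]] polyrepD(1) that by (auto simp: c_def Abs_lop_inverse)
  have c: "c k \<in> Mlop" for k
    using Rep_c[of k] cs[of k] Mlop_intros(4) by (cases "k \<le> n") (auto simp: Mlop_def c_def)
  have "x = (\<Sum>k\<le>n. c k * lop_delta ^ k)"
    using assms osum_cong[of n "\<lambda>k. Rep_lop (c k)" cs] Rep_c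
    by (simp add: Rep_lop_inject[symmetric] Rep_lop_osum dexpr_def)
  then have "x - c n * lop_delta ^ n = (\<Sum>k<n. c k * lop_delta ^ k)"
    by (simp add: lessThan_Suc_atMost[symmetric])
  then have "R.leads x n (c n)"
    using c unfolding R.leads_def R.filt_def by blast
  moreover have "c n \<noteq> 0"
    using assms Rep_c[of n] by (auto simp: dexpr_def zero_lop.rep_eq)
  ultimately show ?thesis using Rep_c by blast
qed

lemma leads_dexpr:
  assumes "R.leads x n s" "s \<noteq> 0"
  shows "\<exists>cs. dexpr (Rep_lop x) n cs \<and> cs n = Rep_lop s"
proof -
  obtain c where c: "\<forall>k. c k \<in> Mlop" "x - s * lop_delta ^ n = (\<Sum>k<n. c k * lop_delta ^ k)"
    and s: "s \<in> Mlop"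
    using assms(1) unfolding R.leads_def R.filt_def by blast
  define d where "d = c(n := s)"
  have "x = (\<Sum>k<n. c k * lop_delta ^ k) + s * lop_delta ^ n"
    using c(2) by (metis diff_add_cancel)
  also have "\<dots> = (\<Sum>k\<le>n. d k * lop_delta ^ k)"
    by (simp add: d_def lessThan_Suc_atMost[symmetric])
  finally have "Rep_lop x = osum (\<lambda>k. Rep_lop (d k)) n"
    by (simp add: Rep_lop_osum)
  moreover have "Rep_lop (d n) \<noteq> scal 0"
    using assms(2) by (simp add: d_def Rep_lop_inject[symmetric] zero_lop.rep_eq)
  ultimately have "dexpr (Rep_lop x) n (\<lambda>k. Rep_lop (d k))"
    using c(1) s by (auto simp: dexpr_def d_def Mlop_def)
  then show ?thesis by (auto simp: d_def)
qed

text \<open>Uniqueness of the nonzero leading term makes both definite descriptions well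
  defined.\<close>

lemma leads_ord_top:
  assumes "R.leads x n s" "s \<noteq> 0"
  shows "ord (Rep_lop x) = ereal (real n)" "top (Rep_lop x) = Rep_lop s"
proof -
  have "x \<noteq> 0" using assms R.independent by blast
  then have nz: "Rep_lop x \<noteq> scal 0" by (simp add: Rep_lop_inject[symmetric] zero_lop.rep_eq)
  obtain cs where cs: "dexpr (Rep_lop x) n cs" "cs n = Rep_lop s" using leads_dexpr[OF assms] by blast
  have unique: "m = n \<and> ds m = Rep_lop s" if "dexpr (Rep_lop x) m ds" for m ds
    using dexpr_leads[OF that] R.leads_unique assms by metis
  have "(THE n. \<exists>cs. dexpr (Rep_lop x) n cs) = n"
    using cs unique by (intro the_equality) blast+
  with nz show "ord (Rep_lop x) = ereal (real n)" by (simp add: ord_def)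
  have "(THE t. \<exists>n cs. dexpr (Rep_lop x) n cs \<and> t = cs n) = Rep_lop s"
    using cs unique by (intro the_equality) metis+
  with nz show "top (Rep_lop x) = Rep_lop s" by (simp add: top_def)
qed

lemma Rset_Rep_lop: "a \<in> Rset \<Longrightarrow> \<exists>x\<in>Rlop. a = Rep_lop x"
proof -
  assume a: "a \<in> Rset"
  then have "a \<in> linop"
    by (induction rule: Rset.induct)
      (auto simp: e4_def e6_def delta_linop mulw_linop scal_linop addo_linop compo_linop E_holomorphic)
  with a show ?thesis by (intro bexI[of _ "Abs_lop a"]) (simp_all add: Rlop_def Abs_lop_inverse)
qed

lemma Mset_Rep_lop: "a \<in> Mset \<Longrightarrow> \<exists>x\<in>Mlop. a = Rep_lop x"
  using Rset_Rep_lop[OF Mset_subset_Rset] by (auto simp: Mlop_def)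

text \<open>Left polynomials in \<open>delta\<close> are closed under sums and products, so they
  exhaust the generated algebra.\<close>

lemma Rlop_filt: "x \<in> Rlop \<Longrightarrow> \<exists>n. x \<in> R.filt n"
proof (induction rule: Rlop_induct)
  case delta
  show ?case using R.filt_monomial[OF R.one_mem, of 1 2] by auto
next
  case (mem x)
  then show ?case using R.filt_monomial[of x 0 1] by auto
next
  case (add x y)
  then obtain m n where "x \<in> R.filt m" "y \<in> R.filt n" by blast
  then have "x \<in> R.filt (max m n)" "y \<in> R.filt (max m n)" by (auto elim: R.filt_mono[rotated])
  then show ?case using R.filt_add by blast
next
  case (mult x y)
  then obtain m n where "x \<in> R.filt m" "y \<in> R.filt n" by blast
  then have "y \<in> R.filt (Suc n)" by (auto elim: R.filt_mono[rotated])
  then show ?case using R.filt_mult \<open>x \<in> R.filt m\<close> by blast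
qed

lemma filt_Rlop: "x \<in> R.filt n \<Longrightarrow> x \<in> Rlop"
proof (unfold R.filt_def, clarify)
  fix c :: "nat \<Rightarrow> lop" assume c: "\<forall>k. c k \<in> Mlop"
  have "lop_delta ^ k \<in> Rlop" for k :: nat by (induction k) (auto intro: Rlop_intros)
  then show "(\<Sum>k<n. c k * lop_delta ^ k) \<in> Rlop"
    using c by (induction n) (simp_all add: Rlop_intros Mlop_subset_Rlop)
qed

text \<open>A finite order excludes \<open>scal 0\<close>, whose order is minus infinity; any other
  element has a nonzero leading term, which \<open>ord\<close> and \<open>top\<close> must
  return.\<close>

lemma ord_leads:
  assumes "a \<in> Rset" "ord a = ereal (real n)"
  shows "\<exists>x s. a = Rep_lop x \<and> top a = Rep_lop s \<and> s \<noteq> 0 \<and> R.leads x n s"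
proof -
  obtain x where x: "x \<in> Rlop" "a = Rep_lop x" using assms Rset_Rep_lop by blast
  have "x \<noteq> 0" using assms(2) x(2) by (auto simp: ord_def zero_lop.rep_eq)
  then obtain k s where ks: "s \<noteq> 0" "R.leads x k s" using Rlop_filt[OF x(1)] R.filt_leads by metis
  with leads_ord_top[OF ks(2,1)] assms(2) x show ?thesis by auto
qed

lemma filt_ord_less:
  assumes "x \<in> R.filt n"
  shows "ord (Rep_lop x) < ereal (real n)"
proof (cases "x = 0")
  case True
  then show ?thesis by (simp add: ord_def zero_lop.rep_eq)
next
  case False
  then obtain k s where "k < n" "s \<noteq> 0" "R.leads x k s" using R.filt_leads assms by blast
  then show ?thesis by (simp add: leads_ord_top)
qed

theorem theorem3p9:
  fixes a b d a' b' :: rop and i j :: nat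
  assumes "a \<in> Rset" and "b \<in> Rset"
    and "ord a = ereal (real i)" and "ord b = ereal (real j)" and "j \<le> i"
    and "d \<in> Mset" and "a' \<in> Mset" and "b' \<in> Mset"
    and "top a = compo a' d" and "top b = compo b' d"
  shows "(\<exists>c c'. c \<in> Rset \<and> c' \<in> Rset \<and> ord c = ereal (real (i - j)) \<and> ord c' < ereal (real j) \<and>
            compo (compo (opow (top b) (i - j)) b') a = addo (compo c b) c')
       \<and> (\<exists>c c'. c \<in> Rset \<and> c' \<in> Rset \<and> ord c = ereal (real (i - j)) \<and> ord c' < ereal (real j) \<and>
            compo (compo a (opow (top b) (i - j))) b' = addo (compo b c) c')"
proof -
  define m where "m = i - j"
  have i: "i = j + m" using assms(5) by (simp add: m_def)
  obtain x s where x: "a = Rep_lop x" "top a = Rep_lop s" "s \<noteq> 0" "R.leads x (j + m) s"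
    using ord_leads[OF assms(1,3)] i by auto
  obtain y t where y: "b = Rep_lop y" "top b = Rep_lop t" "t \<noteq> 0" "R.leads y j t"
    using ord_leads[OF assms(2,4)] by auto
  obtain d\<^sub>1 a\<^sub>1 b\<^sub>1 where M: "d\<^sub>1 \<in> Mlop" "a\<^sub>1 \<in> Mlop" "b\<^sub>1 \<in> Mlop"
    and rep: "d = Rep_lop d\<^sub>1" "a' = Rep_lop a\<^sub>1" "b' = Rep_lop b\<^sub>1"
    using assms(6-8) Mset_Rep_lop by metis
  have s: "s = a\<^sub>1 * d\<^sub>1" and t: "t = b\<^sub>1 * d\<^sub>1"
    using assms(9,10) x(2) y(2) rep by (simp_all add: Rep_lop_inject[symmetric] times_lop.rep_eq)
  have tM: "t \<in> Mlop" using y(4) by (simp add: R.leads_def)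
  \<comment> \<open>The factor \<open>a\<^sub>1\<close> of \<open>s \<noteq> 0\<close> is nonzero,
    and so is \<open>t\<close>. As \<open>Mlop\<close> is a domain, the leading coefficients of both
    quotients are nonzero, which makes their orders exactly \<open>m\<close>.\<close>
  have "a\<^sub>1 \<noteq> 0" using x(3) s by auto
  then have nz: "t ^ m * a\<^sub>1 \<noteq> 0" "a\<^sub>1 * t ^ m \<noteq> 0"
    using R.no_zero_divisors[OF R.power_mem[OF tM] M(2)] R.no_zero_divisors[OF M(2) R.power_mem[OF tM]]
      R.power_nonzero[OF tM y(3)] by blast+
  have memR: "Rep_lop c \<in> Rset" if "c \<in> R.filt n" for c n
    using filt_Rlop[OF that] by (simp add: Rlop_def)
  obtain c c' where c: "c' \<in> R.filt j" "R.leads c m (t ^ m * a\<^sub>1)" "t ^ m * b\<^sub>1 * x = c * y + c'"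
    using R.common_divisor_division_left[OF x(4)[unfolded s] y(4)[unfolded t] M(2,3,1)] t by blast
  have "compo (compo (opow (top b) (i - j)) b') a = addo (compo (Rep_lop c) b) (Rep_lop c')"
    using arg_cong[OF c(3), of Rep_lop]
    unfolding y(2) unfolding x(1) y(1) rep m_def[symmetric]
    by (simp add: times_lop.rep_eq plus_lop.rep_eq Rep_lop_power)
  moreover obtain e e' where e: "e' \<in> R.filt j" "R.leads e m (a\<^sub>1 * t ^ m)" "x * t ^ m * b\<^sub>1 = y * e + e'"
    using R.common_divisor_division_right[OF x(4)[unfolded s] y(4)[unfolded t] M(2,3,1)] t by blast
  have "compo (compo a (opow (top b) (i - j))) b' = addo (compo b (Rep_lop e)) (Rep_lop e')"
    using arg_cong[OF e(3), of Rep_lop]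
    unfolding y(2) unfolding x(1) y(1) rep m_def[symmetric]
    by (simp add: times_lop.rep_eq plus_lop.rep_eq Rep_lop_power)
  ultimately show ?thesis
    using leads_ord_top(1)[OF c(2) nz(1)] leads_ord_top(1)[OF e(2) nz(2)] filt_ord_less[OF c(1)]
      filt_ord_less[OF e(1)] memR[OF c(1)] memR[OF e(1)] memR[OF R.leads_filt[OF c(2)]]
      memR[OF R.leads_filt[OF e(2)]]
    unfolding m_def by blast
qed

end
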